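(* Let $\mathbb{K}$ be the projective Fraïssé limit of $\mathcal{K}$, let $q:\mathbb{K}\to K=\mathbb{K}/R^{\mathbb{K}}$ be the quotient map onto the universal Knaster continuum $K$, and let $\Phi:\mathrm{Aut}(\mathbb{K})\to\mathrm{Homeo}(K)$ be given by $\Phi(f)(q(x))=q(f(x))$. Then the image of $\Phi$ is dense in $\mathrm{Homeo}(K)$.
   Context: For an integer $n\ge 2$, $\langle n\rangle$ denotes the pointed finite linear graph with vertex set $\{0,\dots,n-1\}$, edge relation $(i,j)\in R \iff |i-j|\le 1$, and zero-vertex $0$; every pointed finite linear graph (finite path with loops at all vertices and a designated end vertex, the zero-vertex) is isomorphic to some $\langle n\rangle$. An epimorphism takes edges to edges, is surjective on vertices and edges, and preserves the zero-vertex. $\mathcal{K}$ is the category of pointed finite linear graphs whose morphisms are all epimorphisms $f:\langle n\rangle\to\langle m\rangle$ for which there exist $0=i_0<\cdots<i_k=n-1$ such that $f$ restricted to each $[i_j,i_{j+1}]$ is monotone (non-increasing or non-decreasing), $f(i_j)=m-1$ for $j$ odd and $f(i_j)=0$ for $j$ even. $\mathcal{K}^\omega$ is the category of topological pointed graphs $\mathbb{L}=\varprojlim(L_n,g_n^{n+1})$ with $L_n\in\mathcal{K}$ and $g_n^{n+1}:L_{n+1}\to L_n$ in $\mathcal{K}$, with the product topology (each $L_n$ discrete), relation $(x,y)\in R^{\mathbb{L}}\iff (x_n,y_n)\in R^{L_n}$ for all $n$, and point $c^{\mathbb{L}}=(c^{L_n})_n$, where $c^{L_n}$ is the zero-vertex.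 A map $\phi:\varprojlim(K_n,f_n^{n+1})\to\varprojlim(L_n,g_n^{n+1})$ is a morphism of $\mathcal{K}^\omega$ if there are $i_1<i_2<\cdots$ and $\phi_n:K_{i_n}\to L_n$ in $\mathcal{K}$ with $\pi_n\circ\phi=\phi_n\circ\pi_{i_n}$ for every $n$. Objects of $\mathcal{K}$ are viewed in $\mathcal{K}^\omega$ as constant sequences. The projective Fraïssé limit $\mathbb{K}$ is the object of $\mathcal{K}^\omega$, unique up to isomorphism, such that (1) for each $A\in\mathcal{K}$ there is a morphism $\mathbb{K}\to A$; (2) for $A,B\in\mathcal{K}$ and morphisms $f:\mathbb{K}\to A$, $g:B\to A$ there is a morphism $h:\mathbb{K}\to B$ with $g\circ h=f$. $\mathrm{Aut}(\mathbb{K})$ is the group of automorphisms of $\mathbb{K}$ in $\mathcal{K}^\omega$. The relation $R^{\mathbb{K}}$ is an equivalence relation and $K:=\mathbb{K}/R^{\mathbb{K}}$ is the universal Knaster continuum, i.e. the (unique up to homeomorphism) Knaster continuum admitting continuous open surjections onto all Knaster continua; a Knaster continuum is a space $\varprojlim([0,1],T_n^{n+1})$ with each $T_n^{n+1}:[0,1]\to[0,1]$ a continuous open surjection fixing $0$. $\mathrm{Homeo}(K)$, the group of homeomorphisms of $K$, carries the topology of uniform convergence. *)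

theory Defs
  imports "HOL-Analysis.Analysis"
begin

section \<open>The category of pointed finite linear graphs\<close>

text \<open>The graph \<open>\<langle>n\<rangle>\<close> has vertex set \<open>{..<n}\<close> and zero-vertex \<open>0\<close>.  Every pointed finite linear
  graph is isomorphic to some \<open>\<langle>n\<rangle>\<close> with \<open>n \<ge> 2\<close>, so these are taken as the objects.\<close>

definition path_edges :: "nat \<Rightarrow> (nat \<times> nat) set"
  where "path_edges n = {(i, j). i < n \<and> j < n \<and> \<bar>int i - int j\<bar> \<le> 1}"

definition path_epi :: "nat \<Rightarrow> nat \<Rightarrow> (nat \<Rightarrow> nat) \<Rightarrow> bool"
  where "path_epi n m f \<longleftrightarrow>
    f ` {..<n} = {..<m} \<and> map_prod f f ` path_edges n = path_edges m \<and> f 0 = 0"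

definition K_mor :: "nat \<Rightarrow> nat \<Rightarrow> (nat \<Rightarrow> nat) \<Rightarrow> bool"
  where "K_mor n m f \<longleftrightarrow> path_epi n m f \<and>
    (\<exists>k i. strict_mono_on {..k} i \<and> i 0 = 0 \<and> i k = n - 1 \<and>
       (\<forall>j<k. mono_on {i j..i (Suc j)} f \<or> antimono_on {i j..i (Suc j)} f) \<and>
       (\<forall>j\<le>k. f (i j) = (if odd j then m - 1 else 0)))"


section \<open>Inverse limits\<close>

text \<open>\<open>lev S n\<close> is the number of vertices of the \<open>n\<close>-th graph and \<open>bond S n\<close> is the bonding map
  from level \<open>n + 1\<close> to level \<open>n\<close>; only its values on \<open>{..<lev S (Suc n)}\<close> matter.\<close>

record inv_seq =
  lev :: "nat \<Rightarrow> nat"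
  bond :: "nat \<Rightarrow> nat \<Rightarrow> nat"

definition Komega_obj :: "inv_seq \<Rightarrow> bool"
  where "Komega_obj S \<longleftrightarrow> (\<forall>n. 2 \<le> lev S n \<and> K_mor (lev S (Suc n)) (lev S n) (bond S n))"

definition lim_pts :: "inv_seq \<Rightarrow> (nat \<Rightarrow> nat) set"
  where "lim_pts S = {x. \<forall>n. x n < lev S n \<and> bond S n (x (Suc n)) = x n}"

definition lim_top :: "inv_seq \<Rightarrow> (nat \<Rightarrow> nat) topology"
  where "lim_top S =
    subtopology (product_topology (\<lambda>n. discrete_topology {..<lev S n}) UNIV) (lim_pts S)"

definition lim_rel :: "inv_seq \<Rightarrow> ((nat \<Rightarrow> nat) \<times> (nat \<Rightarrow> nat)) set"
  where "lim_rel S =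
    {(x, y). x \<in> lim_pts S \<and> y \<in> lim_pts S \<and> (\<forall>n. (x n, y n) \<in> path_edges (lev S n))}"

text \<open>Continuity, and preservation of the relation and of the point \<open>\<lambda>n. 0\<close>, all follow from
  the existence of the maps \<open>\<phi>s n\<close> (the \<open>\<phi>\<^sub>n\<close> of the definition of a morphism).\<close>

definition Komega_hom :: "inv_seq \<Rightarrow> inv_seq \<Rightarrow> ((nat \<Rightarrow> nat) \<Rightarrow> nat \<Rightarrow> nat) set"
  where "Komega_hom S T = {\<phi> \<in> lim_pts S \<rightarrow>\<^sub>E lim_pts T.
    \<exists>i \<phi>s. strict_mono i \<and>
      (\<forall>n. K_mor (lev S (i n)) (lev T n) (\<phi>s n) \<and> (\<forall>x\<in>lim_pts S. \<phi> x n = \<phi>s n (x (i n))))}"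

definition Komega_aut :: "inv_seq \<Rightarrow> ((nat \<Rightarrow> nat) \<Rightarrow> nat \<Rightarrow> nat) set"
  where "Komega_aut S = {f \<in> Komega_hom S S.
    \<exists>g\<in>Komega_hom S S. \<forall>x\<in>lim_pts S. g (f x) = x \<and> f (g x) = x}"

definition const_seq :: "nat \<Rightarrow> inv_seq"
  where "const_seq n = \<lparr>lev = \<lambda>_. n, bond = \<lambda>_ x. x\<rparr>"

definition fraisse_limit :: "inv_seq \<Rightarrow> bool"
  where "fraisse_limit S \<longleftrightarrow> Komega_obj S \<and>
    (\<forall>a\<ge>2. Komega_hom S (const_seq a) \<noteq> {}) \<and>
    (\<forall>a\<ge>2. \<forall>b\<ge>2. \<forall>f\<in>Komega_hom S (const_seq a). \<forall>g\<in>Komega_hom (const_seq b) (const_seq a).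
       \<exists>h\<in>Komega_hom S (const_seq b). \<forall>x\<in>lim_pts S. g (h x) = f x)"


section \<open>The quotient and its homeomorphisms\<close>

text \<open>For a Fraisse limit \<open>S\<close>, the relation \<open>lim_rel S\<close> is an equivalence relation
  (\<open>equiv_lim_rel\<close> below) and \<open>quot_top S\<close>, the set of its classes with the quotient topology,
  is the universal Knaster continuum.\<close>

definition quot_map :: "inv_seq \<Rightarrow> (nat \<Rightarrow> nat) \<Rightarrow> (nat \<Rightarrow> nat) set"
  where "quot_map S x = lim_rel S `` {x}"

definition quot_top :: "inv_seq \<Rightarrow> (nat \<Rightarrow> nat) set topology"
  where "quot_top S = topology (\<lambda>U. U \<subseteq> lim_pts S // lim_rel S \<and>
    openin (lim_top S) {x \<in> lim_pts S. quot_map S x \<in> U})"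

definition Homeo :: "'a topology \<Rightarrow> ('a \<Rightarrow> 'a) set"
  where "Homeo X = {h \<in> extensional (topspace X). homeomorphic_map X X h}"

text \<open>The topology of uniform convergence with respect to the metric \<open>m\<close>.  For compact \<open>X\<close> and
  \<open>m\<close> inducing the topology of \<open>X\<close>, every element of \<open>Homeo X\<close> is a point of \<open>cfunspace X m\<close>.\<close>

definition Homeo_top :: "'a topology \<Rightarrow> 'a metric \<Rightarrow> ('a \<Rightarrow> 'a) topology"
  where "Homeo_top X m = subtopology (mtopology_of (cfunspace X m)) (Homeo X)"

text \<open>Existence and uniqueness of the map described here, for an automorphism \<open>f\<close> of a
  Fraisse limit, is \<open>Phi_ex1\<close> below; that it lies in \<open>Homeo (quot_top S)\<close> is
  \<open>Phi_well_defined\<close>.\<close>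

definition Phi :: "inv_seq \<Rightarrow> ((nat \<Rightarrow> nat) \<Rightarrow> nat \<Rightarrow> nat) \<Rightarrow> (nat \<Rightarrow> nat) set \<Rightarrow> (nat \<Rightarrow> nat) set"
  where "Phi S f = (THE h. h \<in> extensional (topspace (quot_top S)) \<and>
    (\<forall>x\<in>lim_pts S. h (quot_map S x) = quot_map S (f x)))"


section \<open>Well-definedness\<close>

lemma K_mor_lt: "K_mor n m f \<Longrightarrow> x < n \<Longrightarrow> f x < m"
  unfolding K_mor_def path_epi_def by blast

lemma K_mor_edge: "K_mor n m f \<Longrightarrow> (x, y) \<in> path_edges n \<Longrightarrow> (f x, f y) \<in> path_edges m"
  unfolding K_mor_def path_epi_def by force

lemma topspace_lim_top [simp]: "topspace (lim_top S) = lim_pts S"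
  by (auto simp: lim_top_def lim_pts_def)

lemma istopology_quot:
  "istopology (\<lambda>U. U \<subseteq> lim_pts S // lim_rel S \<and> openin (lim_top S) {x \<in> lim_pts S. quot_map S x \<in> U})"
  (is "istopology ?P")
proof -
  have "?P (U \<inter> V)" if "?P U" "?P V" for U V
  proof -
    have "{x \<in> lim_pts S. quot_map S x \<in> U \<inter> V} =
      {x \<in> lim_pts S. quot_map S x \<in> U} \<inter> {x \<in> lim_pts S. quot_map S x \<in> V}" by auto
    then show ?thesis using that by (auto simp: openin_Int)
  qed
  moreover have "?P (\<Union>\<K>)" if "\<forall>U\<in>\<K>. ?P U" for \<K>
  proof -
    have "{x \<in> lim_pts S. quot_map S x \<in> \<Union>\<K>} =
      (\<Union>U\<in>\<K>. {x \<in> lim_pts S. quot_map S x \<in> U})" by auto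
    then show ?thesis using that by (auto simp: openin_Union)
  qed
  ultimately show ?thesis unfolding istopology_def by blast
qed

lemma openin_quot_top:
  "openin (quot_top S) U \<longleftrightarrow> U \<subseteq> lim_pts S // lim_rel S \<and>
    openin (lim_top S) {x \<in> lim_pts S. quot_map S x \<in> U}"
  unfolding quot_top_def using istopology_quot[of S] by (simp add: topology_inverse')

lemma quot_map_image: "quot_map S ` lim_pts S = lim_pts S // lim_rel S"
  by (auto simp: quotient_def quot_map_def)

lemma topspace_quot_top [simp]: "topspace (quot_top S) = lim_pts S // lim_rel S"
proof
  show "topspace (quot_top S) \<subseteq> lim_pts S // lim_rel S"
    using openin_quot_top by blast
  have "{x \<in> lim_pts S. quot_map S x \<in> lim_pts S // lim_rel S} = lim_pts S"
    using quot_map_image by blast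
  moreover have "openin (lim_top S) (lim_pts S)"
    using openin_topspace[of "lim_top S"] by simp
  ultimately have "openin (quot_top S) (lim_pts S // lim_rel S)"
    by (simp add: openin_quot_top)
  then show "lim_pts S // lim_rel S \<subseteq> topspace (quot_top S)"
    by (rule openin_subset)
qed

lemma quotient_map_quot_map: "quotient_map (lim_top S) (quot_top S) (quot_map S)"
  unfolding quotient_map_def
  by (auto simp: quot_map_image openin_quot_top)


subsection \<open>Composition of morphisms\<close>

inductive zigzag :: "(nat \<Rightarrow> nat) \<Rightarrow> nat \<Rightarrow> nat \<Rightarrow> nat \<Rightarrow> bool" for f m a where
  refl: "f a \<in> {0, m} \<Longrightarrow> zigzag f m a a"
| step: "zigzag f m a b \<Longrightarrow> b < c \<Longrightarrow> mono_on {b..c} f \<or> antimono_on {b..c} f \<Longrightarrow>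
    f c = m - f b \<Longrightarrow> zigzag f m a c"

lemma zigzag_trans: "zigzag f m b c \<Longrightarrow> zigzag f m a b \<Longrightarrow> zigzag f m a c"
  by (induction rule: zigzag.induct) (auto intro: zigzag.step)

lemma zigzag_ends: "zigzag f m a b \<Longrightarrow> a \<le> b \<and> f a \<in> {0, m} \<and> f b \<in> {0, m}"
  by (induction rule: zigzag.induct) auto

lemma zigzagI:
  assumes "strict_mono_on {..k} i" "i 0 = a"
    and "\<And>j. j < k \<Longrightarrow> mono_on {i j..i (Suc j)} f \<or> antimono_on {i j..i (Suc j)} f"
    and "\<And>j. j \<le> k \<Longrightarrow> f (i j) = (if odd j then m else 0)"
  shows "j \<le> k \<Longrightarrow> zigzag f m a (i j)"
proof (induction j)
  case 0
  then show ?case using assms(2) assms(4)[of 0] by (auto intro: zigzag.refl)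
next
  case (Suc j)
  have "i j < i (Suc j)"
    using assms(1) Suc.prems by (auto simp: strict_mono_on_def)
  show ?case
  proof (rule zigzag.step)
    show "zigzag f m a (i j)" using Suc.IH Suc.prems by simp
    show "i j < i (Suc j)" by fact
    show "mono_on {i j..i (Suc j)} f \<or> antimono_on {i j..i (Suc j)} f"
      using assms(3)[of j] Suc.prems by simp
    show "f (i (Suc j)) = m - f (i j)"
      using assms(4)[of j] assms(4)[of "Suc j"] Suc.prems by simp
  qed
qed

lemma zigzagE:
  "zigzag f m a b \<Longrightarrow> f a = 0 \<Longrightarrow> \<exists>k i. strict_mono_on {..k} i \<and> i 0 = a \<and> i k = b \<and>
    (\<forall>j<k. mono_on {i j..i (Suc j)} f \<or> antimono_on {i j..i (Suc j)} f) \<and>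
    (\<forall>j\<le>k. f (i j) = (if odd j then m else 0))"
proof (induction rule: zigzag.induct)
  case refl
  then show ?case
    by (intro exI[of _ 0] exI[of _ "\<lambda>_. a"]) (auto simp: strict_mono_on_def)
next
  case (step b c)
  then obtain k i where *: "strict_mono_on {..k} i" "i 0 = a" "i k = b"
    "\<And>j. j < k \<Longrightarrow> mono_on {i j..i (Suc j)} f \<or> antimono_on {i j..i (Suc j)} f"
    "\<And>j. j \<le> k \<Longrightarrow> f (i j) = (if odd j then m else 0)" by blast
  define i' where "i' = i(Suc k := c)"
  have le: "i j \<le> b" if "j \<le> k" for j
    using strict_mono_onD[OF *(1), of j k] *(3) that by (cases "j = k") auto
  have "strict_mono_on {..Suc k} i'"
  proof (rule strict_mono_onI)
    fix r s assume rs: "r \<in> {..Suc k}" "s \<in> {..Suc k}" "r < s"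
    show "i' r < i' s"
    proof (cases "s = Suc k")
      case True
      then show ?thesis using le[of r] rs step.hyps(2) by (simp add: i'_def)
    next
      case False
      then show ?thesis using strict_mono_onD[OF *(1), of r s] rs by (simp add: i'_def)
    qed
  qed
  moreover have "i' 0 = a" "i' (Suc k) = c" using * by (auto simp: i'_def)
  moreover have "mono_on {i' j..i' (Suc j)} f \<or> antimono_on {i' j..i' (Suc j)} f"
    if "j < Suc k" for j
    using that *(3) *(4)[of j] step.hyps(3) by (cases "j = k") (auto simp: i'_def)
  moreover have "f (i' j) = (if odd j then m else 0)" if "j \<le> Suc k" for j
    using that *(3) *(5)[of j] *(5)[of k] step.hyps(4)
    by (cases "j = Suc k") (auto simp: i'_def)
  ultimately show ?case by (intro exI[of _ "Suc k"] exI[of _ i']) blast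
qed

lemma K_mor_alt: "K_mor n m f \<longleftrightarrow> path_epi n m f \<and> zigzag f (m - 1) 0 (n - 1)"
proof
  assume "K_mor n m f"
  then obtain k i where "path_epi n m f" and *: "strict_mono_on {..k} i" "i 0 = 0" "i k = n - 1"
    "\<And>j. j < k \<Longrightarrow> mono_on {i j..i (Suc j)} f \<or> antimono_on {i j..i (Suc j)} f"
    "\<And>j. j \<le> k \<Longrightarrow> f (i j) = (if odd j then m - 1 else 0)"
    unfolding K_mor_def by blast
  then show "path_epi n m f \<and> zigzag f (m - 1) 0 (n - 1)"
    using zigzagI[OF *(1,2,4,5), of k] by auto
next
  assume "path_epi n m f \<and> zigzag f (m - 1) 0 (n - 1)"
  then show "K_mor n m f"
    using zigzagE[of f "m - 1" 0 "n - 1"] unfolding K_mor_def path_epi_def by simp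
qed

lemma discrete_ivt:
  fixes f :: "nat \<Rightarrow> nat"
  assumes "\<And>j. a \<le> j \<Longrightarrow> j < b \<Longrightarrow> \<bar>int (f (Suc j)) - int (f j)\<bar> \<le> 1"
    and "a \<le> b" "f a \<le> v \<and> v \<le> f b \<or> f b \<le> v \<and> v \<le> f a"
  shows "\<exists>t\<in>{a..b}. f t = v"
  using \<open>a \<le> b\<close> assms(1,3)
proof (induction b rule: dec_induct)
  case base
  then have "f a = v" by linarith
  then show ?case by auto
next
  case (step b)
  show ?case
  proof (cases "f a \<le> v \<and> v \<le> f b \<or> f b \<le> v \<and> v \<le> f a")
    case True
    have "\<exists>t\<in>{a..b}. f t = v"
      by (rule step.IH[OF _ True]) (simp add: step.prems(1))
    then obtain t where "t \<in> {a..b}" "f t = v" by blast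
    then show ?thesis by (intro bexI[of _ t]) simp_all
  next
    case False
    have "\<bar>int (f (Suc b)) - int (f b)\<bar> \<le> 1" using step.prems(1)[of b] step.hyps by simp
    with False step.prems(2) have "f (Suc b) = v" by linarith
    then show ?thesis using step.hyps by (intro bexI[of _ "Suc b"]) simp_all
  qed
qed

lemma zigzag_comp_up:
  assumes "zigzag g l p q"
    and "mono_on {b..c} f" "b \<le> c" "f b = p" "f c = r" "q \<le> r"
    and lip: "\<And>j. b \<le> j \<Longrightarrow> j < c \<Longrightarrow> \<bar>int (f (Suc j)) - int (f j)\<bar> \<le> 1"
    and "t \<in> {b..c}" "f t = q" "p < q \<or> t = b"
  shows "zigzag (g \<circ> f) l b t"
  using assms(1) assms(6,8-)
proof (induction arbitrary: t rule: zigzag.induct)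
  case refl
  then show ?case using assms(4) by (auto intro: zigzag.refl)
next
  case (step u w)
  have "p \<le> u" using step.hyps(1) zigzag_ends by blast
  have tb: "b \<le> t" "t \<le> c" "f t = w" using step.prems by auto
  obtain s where s: "s \<in> {b..t}" "f s = u" "p < u \<or> s = b"
  proof (cases "p = u")
    case True
    then show ?thesis using that[of b] assms(4) tb by auto
  next
    case False
    have "\<exists>s\<in>{b..t}. f s = u"
      using tb \<open>p \<le> u\<close> step.hyps(2) assms(4) by (intro discrete_ivt lip) auto
    then show ?thesis using False \<open>p \<le> u\<close> that by force
  qed
  have z: "zigzag (g \<circ> f) l b s"
    using step s tb by (intro step.IH) auto
  have "s < t"
    using s tb step.hyps(2) by (cases "s = t") auto
  have mf: "mono_on {s..t} f"
    using assms(2) by (rule mono_on_subset) (use s tb in auto)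
  have im: "f x \<in> {u..w}" if "x \<in> {s..t}" for x
    using mf that s(2) tb(3) unfolding mono_on_def by force
  have "mono_on {s..t} (g \<circ> f) \<or> antimono_on {s..t} (g \<circ> f)"
    using step.hyps(3) mf im unfolding monotone_on_def o_def by blast
  moreover have "(g \<circ> f) t = l - (g \<circ> f) s"
    using step.hyps(4) s tb by simp
  ultimately show ?case by (rule zigzag.step[OF z \<open>s < t\<close>])
qed

lemma zigzag_rev:
  assumes "zigzag f m a b" "b \<le> N"
  shows "zigzag (\<lambda>x. f (N - x)) m (N - b) (N - a)"
  using assms
proof (induction rule: zigzag.induct)
  case refl
  then show ?case by (auto intro: zigzag.refl)
next
  case (step b c)
  have fb: "f b \<in> {0, m}" "a \<le> b" using step.hyps(1) zigzag_ends by blast+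
  have "zigzag (\<lambda>x. f (N - x)) m (N - c) (N - c)"
    using fb step.hyps(4) step.prems by (intro zigzag.refl) auto
  then have "zigzag (\<lambda>x. f (N - x)) m (N - c) (N - b)"
  proof (rule zigzag.step)
    show "N - c < N - b" using step by auto
    have *: "N - x \<in> {b..c}" if "x \<in> {N - c..N - b}" for x
      using that step.prems step.hyps(2) by auto
    have **: "N - y \<le> N - x" if "x \<le> y" for x y :: nat using that by auto
    show "mono_on {N - c..N - b} (\<lambda>x. f (N - x)) \<or> antimono_on {N - c..N - b} (\<lambda>x. f (N - x))"
      using step.hyps(3) * ** unfolding monotone_on_def by meson
    show "f (N - (N - b)) = m - f (N - (N - c))"
      using fb step by auto
  qed
  moreover have "zigzag (\<lambda>x. f (N - x)) m (N - b) (N - a)"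
    using step by auto
  ultimately show ?case by (rule zigzag_trans[rotated])
qed

lemma zigzag_comp:
  assumes "zigzag f r 0 d" "0 < r"
    and g: "zigzag g l 0 r" 
    and lip: "\<And>j. j < d \<Longrightarrow> \<bar>int (f (Suc j)) - int (f j)\<bar> \<le> 1"
  shows "zigzag (g \<circ> f) l 0 d"
  using assms(1) lip
proof (induction rule: zigzag.induct)
  case refl
  then show ?case using zigzag_ends[OF g] by (auto intro: zigzag.refl)
next
  case (step b c)
  have fb: "f b \<in> {0, r}" using step.hyps(1) zigzag_ends by blast
  have "zigzag (g \<circ> f) l b c"
  proof (cases "f b = 0")
    case True
    then have fc: "f c = r" using step by simp
    have "mono_on {b..c} f"
    proof -
      have False if "antimono_on {b..c} f"
        using monotone_onD[OF that, of b c] True fc assms(2) step.hyps(2) by auto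
      then show ?thesis using step.hyps(3) by blast
    qed
    then show ?thesis
      using step.hyps(2) True fc assms(2) step.prems
      by (intro zigzag_comp_up[OF g]) auto
  next
    case False
    then have fbc: "f b = r" "f c = 0" using fb step by auto
    have anti: "antimono_on {b..c} f"
    proof -
      have False if "mono_on {b..c} f"
        using monotone_onD[OF that, of b c] fbc assms(2) step.hyps(2) by auto
      then show ?thesis using step.hyps(3) by blast
    qed
    have le: "f x \<le> r" if "x \<in> {b..c}" for x
      using monotone_onD[OF anti, of b x] that fbc step.hyps(2) by auto
    define f' where "f' = (\<lambda>x. f (c - x))"
    have mono: "mono_on {0..c - b} f'"
    proof (rule monotone_onI)
      fix x y assume "x \<in> {0..c - b}" "y \<in> {0..c - b}" "x \<le> y"
      then have "c - y \<in> {b..c}" "c - x \<in> {b..c}" "c - y \<le> c - x"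
        using step.hyps(2) by auto
      then show "f' x \<le> f' y"
        using monotone_onD[OF anti, of "c - y" "c - x"] by (simp add: f'_def)
    qed
    have "zigzag (g \<circ> f') l 0 (c - b)"
    proof (rule zigzag_comp_up[OF g mono])
      show "\<bar>int (f' (Suc j)) - int (f' j)\<bar> \<le> 1" if "0 \<le> j" "j < c - b" for j
      proof -
        have "Suc (c - Suc j) = c - j" using that by auto
        then show ?thesis
          using step.prems[of "c - Suc j"] that by (simp add: f'_def abs_minus_commute)
      qed
    qed (use fbc step.hyps(2) assms(2) in \<open>auto simp: f'_def\<close>)
    from zigzag_rev[OF this, of c] have "zigzag (\<lambda>x. g (f (c - (c - x)))) l b c"
      using step.hyps(2) by (auto simp: f'_def)
    then show ?thesis
    proof -
      have eq: "zigzag h l u v \<Longrightarrow> (\<And>x. x \<le> v \<Longrightarrow> h x = h' x) \<Longrightarrow> zigzag h' l u v" for h h' u v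
      proof (induction rule: zigzag.induct)
        case refl
        then show ?case by (auto intro: zigzag.refl)
      next
        case (step p q)
        have "u \<le> p" using step.hyps(1) zigzag_ends by blast
        then show ?case
          using step by (intro zigzag.step[of h' l u p q]) (auto simp: monotone_on_def)
      qed
      show ?thesis
        by (rule eq[OF \<open>zigzag (\<lambda>x. g (f (c - (c - x)))) l b c\<close>]) simp
    qed
  qed
  moreover have "zigzag (g \<circ> f) l 0 b" 
  proof (rule step.IH)
    show "\<bar>int (f (Suc j)) - int (f j)\<bar> \<le> 1" if "j < b" for j
      using step.prems[of j] that step.hyps(2) by simp
  qed
  ultimately show ?case by (rule zigzag_trans)
qed

lemma K_mor_comp:
  assumes f: "K_mor a b f" and g: "K_mor b c g" and "2 \<le> b"
  shows "K_mor a c (g \<circ> f)"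
proof -
  have ff: "path_epi a b f" "zigzag f (b - 1) 0 (a - 1)"
    and gg: "path_epi b c g" "zigzag g (c - 1) 0 (b - 1)" using f g by (auto simp: K_mor_alt)
  have "path_epi a c (g \<circ> f)"
    using ff(1) gg(1) by (simp only: path_epi_def image_comp[symmetric] map_prod.comp[symmetric] o_apply)
  moreover have "zigzag (g \<circ> f) (c - 1) 0 (a - 1)"
  proof (rule zigzag_comp[OF ff(2) _ gg(2)])
    show "\<bar>int (f (Suc j)) - int (f j)\<bar> \<le> 1" if "j < a - 1" for j
    proof -
      have "(Suc j, j) \<in> path_edges a" using that by (auto simp: path_edges_def)
      from K_mor_edge[OF f this] show ?thesis by (simp add: path_edges_def)
    qed
  qed (use \<open>2 \<le> b\<close> in auto)
  ultimately show ?thesis by (simp add: K_mor_alt)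
qed

lemma K_mor_id: "2 \<le> n \<Longrightarrow> K_mor n n (\<lambda>x. x)"
proof -
  assume "2 \<le> n"
  have "zigzag (\<lambda>x. x) (n - 1) 0 (n - 1)"
  proof (rule zigzag.step[of _ _ 0 0 "n - 1"])
    show "zigzag (\<lambda>x. x) (n - 1) 0 0" by (rule zigzag.refl) simp
    show "mono_on {0..n - 1} (\<lambda>x. x) \<or> antimono_on {0..n - 1} (\<lambda>x. x)"
      by (simp add: monotone_on_def)
  qed (use \<open>2 \<le> n\<close> in simp_all)
  moreover have "path_epi n n (\<lambda>x. x)"
    by (simp add: path_epi_def map_prod_def)
  ultimately show ?thesis by (simp add: K_mor_alt)
qed

lemma Komega_hom_proj:
  assumes "Komega_obj S"
  shows "(\<lambda>x\<in>lim_pts S. \<lambda>_. x n) \<in> Komega_hom S (const_seq (lev S n))"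
proof -
  have ex: "\<exists>\<psi>. K_mor (lev S (n + k)) (lev S n) \<psi> \<and> (\<forall>x\<in>lim_pts S. x n = \<psi> (x (n + k)))" for k
  proof (induction k)
    case 0
    have "2 \<le> lev S n" using assms by (simp add: Komega_obj_def)
    then show ?case by (intro exI[of _ "\<lambda>x. x"]) (simp add: K_mor_id)
  next
    case (Suc k)
    then obtain \<psi> where \<psi>: "K_mor (lev S (n + k)) (lev S n) \<psi>"
      "\<forall>x\<in>lim_pts S. x n = \<psi> (x (n + k))" by blast
    have "K_mor (lev S (n + Suc k)) (lev S n) (\<psi> \<circ> bond S (n + k))"
      using assms \<psi>(1) by (intro K_mor_comp[of _ "lev S (n + k)"]) (auto simp: Komega_obj_def)
    moreover have "x n = (\<psi> \<circ> bond S (n + k)) (x (n + Suc k))" if "x \<in> lim_pts S" for x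
      using \<psi>(2) that by (auto simp: lim_pts_def)
    ultimately show ?case by blast
  qed
  then obtain \<psi> where \<psi>: "\<And>k. K_mor (lev S (n + k)) (lev S n) (\<psi> k)"
    "\<And>k x. x \<in> lim_pts S \<Longrightarrow> x n = \<psi> k (x (n + k))" by metis
  have "strict_mono (\<lambda>k. n + k)" by (auto simp: strict_mono_def)
  moreover have "(\<lambda>x\<in>lim_pts S. \<lambda>_. x n) \<in> lim_pts S \<rightarrow>\<^sub>E lim_pts (const_seq (lev S n))"
    by (rule restrict_PiE_iff[THEN iffD2]) (simp add: const_seq_def lim_pts_def)
  moreover have "K_mor (lev S (n + k)) (lev (const_seq (lev S n)) k) (\<psi> k) \<and>
      (\<forall>x\<in>lim_pts S. (\<lambda>x\<in>lim_pts S. \<lambda>_. x n) x k = \<psi> k (x (n + k)))" for k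
  proof (intro conjI ballI)
    show "K_mor (lev S (n + k)) (lev (const_seq (lev S n)) k) (\<psi> k)"
      using \<psi>(1) by (simp add: const_seq_def)
    show "(\<lambda>x\<in>lim_pts S. \<lambda>_. x n) x k = \<psi> k (x (n + k))" if "x \<in> lim_pts S" for x
      using \<psi>(2)[OF that, of k] that by (simp only: restrict_apply' )
  qed
  ultimately show ?thesis
    unfolding Komega_hom_def mem_Collect_eq by blast
qed

lemma Komega_hom_mem: "f \<in> Komega_hom S T \<Longrightarrow> x \<in> lim_pts S \<Longrightarrow> f x \<in> lim_pts T"
  by (auto simp: Komega_hom_def)

lemma Komega_hom_rel:
  assumes "f \<in> Komega_hom S T" "(x, y) \<in> lim_rel S"
  shows "(f x, f y) \<in> lim_rel T"
proof -
  obtain i \<phi> where *: "\<And>n. K_mor (lev S (i n)) (lev T n) (\<phi> n)"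
    "\<And>n x. x \<in> lim_pts S \<Longrightarrow> f x n = \<phi> n (x (i n))"
    using assms(1) unfolding Komega_hom_def by blast
  have "x \<in> lim_pts S" "y \<in> lim_pts S" "\<And>n. (x n, y n) \<in> path_edges (lev S n)"
    using assms(2) by (auto simp: lim_rel_def)
  then show ?thesis
    using * K_mor_edge[OF *(1)] Komega_hom_mem[OF assms(1)] by (auto simp: lim_rel_def)
qed


subsection \<open>The relation is an equivalence relation\<close>

lemma K_mor_div2:
  assumes "2 \<le> m"
  shows "K_mor (2 * m) m (\<lambda>j. j div 2)"
proof -
  have "zigzag (\<lambda>j. j div 2) (m - 1) 0 (2 * m - 1)"
    by (rule zigzag.step[OF zigzag.refl])
       (use assms in \<open>auto simp: monotone_on_def div_le_mono\<close>)
  moreover have "path_epi (2 * m) m (\<lambda>j. j div 2)"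
    unfolding path_epi_def
  proof (intro conjI)
    show "(\<lambda>j. j div 2) ` {..<2 * m} = {..<m}"
    proof
      show "{..<m} \<subseteq> (\<lambda>j. j div 2) ` {..<2 * m}"
      proof
        fix v assume "v \<in> {..<m}"
        then show "v \<in> (\<lambda>j. j div 2) ` {..<2 * m}" by (intro image_eqI[of _ _ "2 * v"]) auto
      qed
    qed auto
    show "map_prod (\<lambda>j. j div 2) (\<lambda>j. j div 2) ` path_edges (2 * m) = path_edges m"
    proof
      show "map_prod (\<lambda>j. j div 2) (\<lambda>j. j div 2) ` path_edges (2 * m) \<subseteq> path_edges m"
      proof clarsimp
        fix a b assume "(a, b) \<in> path_edges (2 * m)"
        then have "a < 2 * m" "b < 2 * m" "a \<le> Suc b" "b \<le> Suc a" by (auto simp: path_edges_def)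
        then have "a div 2 < m" "b div 2 < m" "a div 2 \<le> Suc (b div 2)" "b div 2 \<le> Suc (a div 2)"
          by presburger+
        then show "(a div 2, b div 2) \<in> path_edges m" by (auto simp: path_edges_def)
      qed
      show "path_edges m \<subseteq> map_prod (\<lambda>j. j div 2) (\<lambda>j. j div 2) ` path_edges (2 * m)"
      proof clarsimp
        fix a b assume "(a, b) \<in> path_edges m"
        then have *: "a < m" "b < m" and "a = b \<or> b = Suc a \<or> a = Suc b"
          by (auto simp: path_edges_def)
        then consider "a = b" | "b = Suc a" | "a = Suc b" by blast
        then obtain a' b' where "(a', b') \<in> path_edges (2 * m)" "a' div 2 = a" "b' div 2 = b"
        proof cases
          case 1 then show ?thesis using * by (intro that[of "2*a" "2*a"]) (auto simp: path_edges_def)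
        next
          case 2 then show ?thesis using * by (intro that[of "2*a+1" "2*b"]) (auto simp: path_edges_def)
        next
          case 3 then show ?thesis using * by (intro that[of "2*a" "2*b+1"]) (auto simp: path_edges_def)
        qed
        then show "(a, b) \<in> map_prod (\<lambda>j. j div 2) (\<lambda>j. j div 2) ` path_edges (2 * m)"
          by (intro image_eqI[of _ _ "(a', b')"]) auto
      qed
    qed
  qed simp
  ultimately show ?thesis by (simp add: K_mor_alt)
qed

lemma Komega_hom_const:
  assumes "K_mor b a g"
  shows "(\<lambda>x\<in>lim_pts (const_seq b). \<lambda>n. g (x n)) \<in> Komega_hom (const_seq b) (const_seq a)"
  unfolding Komega_hom_def using assms K_mor_lt[OF assms]
  by (auto simp: const_seq_def lim_pts_def strict_mono_def
      intro!: exI[of _ "\<lambda>k::nat. k"] exI[of _ "\<lambda>_. g"])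

lemma equiv_lim_rel:
  assumes "fraisse_limit S"
  shows "equiv (lim_pts S) (lim_rel S)"
proof (rule equivI)
  show "lim_rel S \<subseteq> lim_pts S \<times> lim_pts S" by (auto simp: lim_rel_def)
  show "refl_on (lim_pts S) (lim_rel S)"
    by (auto simp: refl_on_def lim_rel_def path_edges_def lim_pts_def)
  show "sym (lim_rel S)"
    by (auto simp: sym_def lim_rel_def path_edges_def abs_minus_commute)
  show "trans (lim_rel S)"
  proof (rule transI)
    fix x y z assume xy: "(x, y) \<in> lim_rel S" and yz: "(y, z) \<in> lim_rel S"
    have mem: "x \<in> lim_pts S" "y \<in> lim_pts S" "z \<in> lim_pts S"
      using xy yz by (auto simp: lim_rel_def)
    have obj: "Komega_obj S" using assms by (simp add: fraisse_limit_def)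
    have "(x n, z n) \<in> path_edges (lev S n)" for n
    proof -
      define m where "m = lev S n"
      have "2 \<le> m" using obj by (simp add: m_def Komega_obj_def)
      then have "2 \<le> 2 * m" by simp
      define p where "p = (\<lambda>x\<in>lim_pts S. \<lambda>_::nat. x n)"
      define g where "g = (\<lambda>x\<in>lim_pts (const_seq (2 * m)). \<lambda>n::nat. x n div 2)"
      have "p \<in> Komega_hom S (const_seq m)"
        unfolding p_def m_def by (rule Komega_hom_proj[OF obj])
      moreover have "g \<in> Komega_hom (const_seq (2 * m)) (const_seq m)"
        unfolding g_def by (rule Komega_hom_const[OF K_mor_div2[OF \<open>2 \<le> m\<close>]])
      ultimately obtain h where h: "h \<in> Komega_hom S (const_seq (2 * m))"
        "\<And>x. x \<in> lim_pts S \<Longrightarrow> g (h x) = p x"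
        using assms \<open>2 \<le> m\<close> \<open>2 \<le> 2 * m\<close> unfolding fraisse_limit_def by metis
      have d: "h u 0 div 2 = u n" if "u \<in> lim_pts S" for u
        using fun_cong[OF h(2)[OF that], of 0] that Komega_hom_mem[OF h(1) that]
        by (simp add: g_def p_def)
      have "(h x 0, h y 0) \<in> path_edges (2 * m)" "(h y 0, h z 0) \<in> path_edges (2 * m)"
        using Komega_hom_rel[OF h(1) xy] Komega_hom_rel[OF h(1) yz]
        by (auto simp: lim_rel_def const_seq_def)
      then have "h x 0 \<le> h z 0 + 2" "h z 0 \<le> h x 0 + 2" by (auto simp: path_edges_def)
      then have "h x 0 div 2 \<le> Suc (h z 0 div 2)" "h z 0 div 2 \<le> Suc (h x 0 div 2)"
        by presburger+
      then show ?thesis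
        using d mem by (auto simp: path_edges_def lim_pts_def)
    qed
    then show "(x, z) \<in> lim_rel S" using mem by (auto simp: lim_rel_def)
  qed
qed


subsection \<open>The map on automorphisms\<close>

lemma continuous_map_Komega_hom:
  assumes "f \<in> Komega_hom S T"
  shows "continuous_map (lim_top S) (lim_top T) f"
proof -
  obtain i \<phi> where *: "\<And>n. K_mor (lev S (i n)) (lev T n) (\<phi> n)"
    "\<And>n x. x \<in> lim_pts S \<Longrightarrow> f x n = \<phi> n (x (i n))"
    using assms unfolding Komega_hom_def by blast
  have "continuous_map (lim_top S) (discrete_topology {..<lev T n}) (\<lambda>x. f x n)" for n
  proof (rule continuous_map_eq)
    have "continuous_map (lim_top S) (discrete_topology {..<lev S (i n)}) (\<lambda>x. x (i n))"
      unfolding lim_top_def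
      by (intro continuous_map_from_subtopology continuous_map_product_projection) simp
    moreover have "continuous_map (discrete_topology {..<lev S (i n)})
        (discrete_topology {..<lev T n}) (\<phi> n)"
      using K_mor_lt[OF *(1)] by auto
    ultimately show "continuous_map (lim_top S) (discrete_topology {..<lev T n}) (\<phi> n \<circ> (\<lambda>x. x (i n)))"
      by (rule continuous_map_compose)
    show "(\<phi> n \<circ> (\<lambda>x. x (i n))) x = f x n" if "x \<in> topspace (lim_top S)" for x
      using that *(2) by simp
  qed
  then show ?thesis
    using Komega_hom_mem[OF assms]
    unfolding lim_top_def[of T]
    by (auto simp: continuous_map_in_subtopology continuous_map_componentwise_UNIV)
qed

lemma Phi_ex1:
  assumes "fraisse_limit S" "f \<in> Komega_hom S S"
  shows "\<exists>!h. h \<in> extensional (topspace (quot_top S)) \<and>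
    (\<forall>x\<in>lim_pts S. h (quot_map S x) = quot_map S (f x))"
proof (rule ex_ex1I)
  note eq = equiv_lim_rel[OF assms(1)]
  define h where "h = (\<lambda>c\<in>lim_pts S // lim_rel S. quot_map S (f (SOME x. x \<in> c)))"
  have "h (quot_map S x) = quot_map S (f x)" if x: "x \<in> lim_pts S" for x
  proof -
    have "x \<in> quot_map S x" using equiv_class_self[OF eq x] by (simp add: quot_map_def)
    then have "(SOME y. y \<in> quot_map S x) \<in> quot_map S x"
      by (rule someI[of "\<lambda>y. y \<in> quot_map S x"])
    then have "(x, SOME y. y \<in> quot_map S x) \<in> lim_rel S" by (simp add: quot_map_def)
    from Komega_hom_rel[OF assms(2) this] have "quot_map S (f (SOME y. y \<in> quot_map S x)) = quot_map S (f x)"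
      unfolding quot_map_def by (rule equiv_class_eq[OF eq, symmetric])
    moreover have "quot_map S x \<in> lim_pts S // lim_rel S" using x quot_map_image by blast
    ultimately show ?thesis by (simp add: h_def)
  qed
  then show "\<exists>h. h \<in> extensional (topspace (quot_top S)) \<and>
    (\<forall>x\<in>lim_pts S. h (quot_map S x) = quot_map S (f x))"
    by (intro exI[of _ h]) (auto simp: h_def)
next
  fix h h' assume
    *: "h \<in> extensional (topspace (quot_top S)) \<and> (\<forall>x\<in>lim_pts S. h (quot_map S x) = quot_map S (f x))"
    and **: "h' \<in> extensional (topspace (quot_top S)) \<and> (\<forall>x\<in>lim_pts S. h' (quot_map S x) = quot_map S (f x))"
  show "h = h'"
  proof (rule extensionalityI)
    show "h \<in> extensional (topspace (quot_top S))" "h' \<in> extensional (topspace (quot_top S))"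
      using * ** by auto
    fix c assume "c \<in> topspace (quot_top S)"
    then obtain x where "x \<in> lim_pts S" "c = quot_map S x" using quot_map_image[of S] by auto
    then show "h c = h' c" using * ** by auto
  qed
qed

lemma Phi_eq:
  assumes "fraisse_limit S" "f \<in> Komega_hom S S"
  shows "Phi S f \<in> extensional (topspace (quot_top S))"
    and "x \<in> lim_pts S \<Longrightarrow> Phi S f (quot_map S x) = quot_map S (f x)"
  using theI'[OF Phi_ex1[OF assms]] unfolding Phi_def by auto

lemma continuous_map_Phi:
  assumes "fraisse_limit S" "f \<in> Komega_hom S S"
  shows "continuous_map (quot_top S) (quot_top S) (Phi S f)"
proof (rule continuous_compose_quotient_map[OF quotient_map_quot_map])
  have "continuous_map (lim_top S) (quot_top S) (quot_map S \<circ> f)"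
    using continuous_map_Komega_hom[OF assms(2)] quotient_imp_continuous_map[OF quotient_map_quot_map]
    by (rule continuous_map_compose)
  then show "continuous_map (lim_top S) (quot_top S) (Phi S f \<circ> quot_map S)"
    by (rule continuous_map_eq) (simp add: Phi_eq(2)[OF assms])
qed

lemma Phi_well_defined:
  assumes "fraisse_limit S" "f \<in> Komega_aut S"
  shows "Phi S f \<in> Homeo (quot_top S)"
    and "\<And>x. x \<in> lim_pts S \<Longrightarrow> Phi S f (quot_map S x) = quot_map S (f x)"
proof -
  obtain g where f: "f \<in> Komega_hom S S" and g: "g \<in> Komega_hom S S"
    and fg: "\<And>x. x \<in> lim_pts S \<Longrightarrow> g (f x) = x" "\<And>x. x \<in> lim_pts S \<Longrightarrow> f (g x) = x"
    using assms(2) by (auto simp: Komega_aut_def)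
  show "\<And>x. x \<in> lim_pts S \<Longrightarrow> Phi S f (quot_map S x) = quot_map S (f x)"
    by (rule Phi_eq(2)[OF assms(1) f])
  have "homeomorphic_maps (quot_top S) (quot_top S) (Phi S f) (Phi S g)"
    unfolding homeomorphic_maps_def
    using continuous_map_Phi[OF assms(1) f] continuous_map_Phi[OF assms(1) g]
    by (auto simp: quot_map_image[symmetric] Phi_eq(2)[OF assms(1) f] Phi_eq(2)[OF assms(1) g]
        Komega_hom_mem[OF f] Komega_hom_mem[OF g] fg)
  then show "Phi S f \<in> Homeo (quot_top S)"
    unfolding Homeo_def using Phi_eq(1)[OF assms(1) f] homeomorphic_maps_imp_map by blast
qed

subsection \<open>The quotient is compact and metrizable\<close>

lemma continuous_map_coord:
  "continuous_map (lim_top S) (discrete_topology {..<lev S n}) (\<lambda>x. x n)"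
  unfolding lim_top_def
  by (intro continuous_map_from_subtopology continuous_map_product_projection) simp

lemma compact_Hausdorff_lim_top:
  assumes "Komega_obj S"
  shows "compact_space (lim_top S)" "Hausdorff_space (lim_top S)"
proof -
  define P where "P = product_topology (\<lambda>n. discrete_topology {..<lev S n}) UNIV"
  have pr: "continuous_map P (discrete_topology {..<lev S n}) (\<lambda>x. x n)" for n
    unfolding P_def by (intro continuous_map_product_projection) simp
  have br: "continuous_map P (discrete_topology {..<lev S n}) (\<lambda>x. bond S n (x (Suc n)))" for n
  proof -
    have "K_mor (lev S (Suc n)) (lev S n) (bond S n)" using assms by (simp add: Komega_obj_def)
    then have "continuous_map (discrete_topology {..<lev S (Suc n)})
        (discrete_topology {..<lev S n}) (bond S n)"
      using K_mor_lt by auto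
    from continuous_map_compose[OF pr this] show ?thesis by (simp add: o_def)
  qed
  have "closedin P {x \<in> topspace P. bond S n (x (Suc n)) = x n}" for n
    by (rule closedin_continuous_maps_eq[OF Hausdorff_space_discrete_topology br pr])
  then have "closedin P (\<Inter>n. {x \<in> topspace P. bond S n (x (Suc n)) = x n})"
    by (intro closedin_INT) auto
  moreover have "(\<Inter>n. {x \<in> topspace P. bond S n (x (Suc n)) = x n}) = lim_pts S"
    by (auto simp: P_def lim_pts_def)
  ultimately have cl: "closedin P (lim_pts S)" by simp
  have "compact_space P"
    unfolding P_def by (simp add: compact_space_product_topology compact_space_discrete_topology)
  then have "compactin P (lim_pts S)" using cl by (rule closedin_compact_space)
  then show "compact_space (lim_top S)"
    unfolding lim_top_def P_def by (rule compact_space_subtopology)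
  have "Hausdorff_space P" unfolding P_def by (simp add: Hausdorff_space_product_topology)
  then show "Hausdorff_space (lim_top S)"
    unfolding lim_top_def P_def by (rule Hausdorff_space_subtopology)
qed

lemma compact_quot_top:
  assumes "Komega_obj S"
  shows "compact_space (quot_top S)"
  using quotient_map_quot_map compact_Hausdorff_lim_top(1)[OF assms]
  by (metis compact_space_def image_compactin quotient_imp_continuous_map
      quotient_imp_surjective_map)

lemma closedin_lim_rel: "closedin (prod_topology (lim_top S) (lim_top S)) (lim_rel S)"
proof -
  let ?X = "prod_topology (lim_top S) (lim_top S)"
  have "closedin ?X {p \<in> topspace ?X. (fst p n, snd p n) \<in> path_edges (lev S n)}" for n
  proof (rule closedin_continuous_map_preimage)
    let ?D = "discrete_topology {..<lev S n}"
    have "continuous_map ?X ?D (\<lambda>p. fst p n)" "continuous_map ?X ?D (\<lambda>p. snd p n)"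
      using continuous_map_compose[OF continuous_map_fst continuous_map_coord[of S n]]
        continuous_map_compose[OF continuous_map_snd continuous_map_coord[of S n]]
      by (simp_all add: o_def)
    then show "continuous_map ?X (discrete_topology ({..<lev S n} \<times> {..<lev S n}))
        (\<lambda>p. (fst p n, snd p n))"
      by (simp add: prod_topology_discrete_topology continuous_map_pairedI)
    show "closedin (discrete_topology ({..<lev S n} \<times> {..<lev S n})) (path_edges (lev S n))"
      by (auto simp: path_edges_def)
  qed
  then have "closedin ?X (\<Inter>n. {p \<in> topspace ?X. (fst p n, snd p n) \<in> path_edges (lev S n)})"
    by (intro closedin_INT) auto
  moreover have "(\<Inter>n. {p \<in> topspace ?X. (fst p n, snd p n) \<in> path_edges (lev S n)}) = lim_rel S"
    by (auto simp: lim_rel_def)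
  ultimately show ?thesis by simp
qed

lemma quot_map_eq_iff:
  assumes "fraisse_limit S" "x \<in> lim_pts S" "y \<in> lim_pts S"
  shows "quot_map S x = quot_map S y \<longleftrightarrow> (x, y) \<in> lim_rel S"
  unfolding quot_map_def using eq_equiv_class_iff[OF equiv_lim_rel[OF assms(1)]] assms by blast

lemma closed_map_quot_map:
  assumes "fraisse_limit S"
  shows "closed_map (lim_top S) (quot_top S) (quot_map S)"
  unfolding closed_map_def
proof (intro allI impI)
  fix C assume C: "closedin (lim_top S) C"
  have obj: "Komega_obj S" using assms by (simp add: fraisse_limit_def)
  let ?X = "prod_topology (lim_top S) (lim_top S)"
  have sub: "C \<subseteq> lim_pts S" using closedin_subset[OF C] by simp
  have "closedin ?X (lim_rel S \<inter> C \<times> lim_pts S)"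
    using C closedin_topspace[of "lim_top S"]
    by (intro closedin_Int closedin_lim_rel) (auto simp: closedin_prod_Times_iff)
  then have cl: "closedin (lim_top S) (snd ` (lim_rel S \<inter> C \<times> lim_pts S))"
    using Abstract_Topological_Spaces.closed_map_snd[OF compact_Hausdorff_lim_top(1)[OF obj]]
    unfolding closed_map_def by blast
  have "snd ` (lim_rel S \<inter> C \<times> lim_pts S) = {x \<in> lim_pts S. quot_map S x \<in> quot_map S ` C}"
    (is "?A = ?B")
  proof (rule set_eqI)
    fix y
    have "y \<in> ?A \<longleftrightarrow> y \<in> lim_pts S \<and> (\<exists>x\<in>C. (x, y) \<in> lim_rel S)" by force
    also have "\<dots> \<longleftrightarrow> y \<in> lim_pts S \<and> (\<exists>x\<in>C. quot_map S x = quot_map S y)"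
      using quot_map_eq_iff[OF assms] sub by blast
    also have "\<dots> \<longleftrightarrow> y \<in> ?B" by (auto simp: image_iff)
    finally show "y \<in> ?A \<longleftrightarrow> y \<in> ?B" .
  qed
  then have "closedin (lim_top S) {x \<in> topspace (lim_top S). quot_map S x \<in> quot_map S ` C}"
    using cl by simp
  moreover have "quot_map S ` C \<subseteq> topspace (quot_top S)"
    using sub quot_map_image[of S] by auto
  ultimately show "closedin (quot_top S) (quot_map S ` C)"
    using quotient_map_quot_map[of S] unfolding quotient_map_closedin by blast
qed

lemma Hausdorff_quot_top:
  assumes "fraisse_limit S"
  shows "Hausdorff_space (quot_top S)" "normal_space (quot_top S)"
proof -
  have obj: "Komega_obj S" using assms by (simp add: fraisse_limit_def)
  have surj: "quot_map S ` topspace (lim_top S) = topspace (quot_top S)"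
    by (simp add: quot_map_image)
  have "normal_space (lim_top S)"
    using compact_Hausdorff_lim_top[OF obj] compact_Hausdorff_or_regular_imp_normal_space by blast
  then show n: "normal_space (quot_top S)"
    using quotient_imp_continuous_map[OF quotient_map_quot_map] closed_map_quot_map[OF assms] surj
    by (rule normal_space_continuous_closed_map_image)
  have "t1_space (quot_top S)"
    by (rule t1_space_closed_map_image[OF closed_map_quot_map[OF assms] surj])
       (rule Hausdorff_imp_t1_space[OF compact_Hausdorff_lim_top(2)[OF obj]])
  with n show "Hausdorff_space (quot_top S)" by (rule normal_t1_imp_Hausdorff_space)
qed

lemma lim_pts_edge_mono:
  assumes "Komega_obj S" "x \<in> lim_pts S" "y \<in> lim_pts S"
    and "(x n, y n) \<in> path_edges (lev S n)" "k \<le> n"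
  shows "(x k, y k) \<in> path_edges (lev S k)"
  using \<open>k \<le> n\<close>
proof (induction k rule: inc_induct)
  case base
  then show ?case using assms by simp
next
  case (step k)
  have "K_mor (lev S (Suc k)) (lev S k) (bond S k)" using assms(1) by (simp add: Komega_obj_def)
  from K_mor_edge[OF this step.IH] show ?case using assms(2,3) by (simp add: lim_pts_def)
qed

lemma metrizable_quot_top:
  assumes "fraisse_limit S"
  shows "metrizable_space (quot_top S)"
proof -
  have obj: "Komega_obj S" using assms by (simp add: fraisse_limit_def)
  note comp = compact_Hausdorff_lim_top(1)[OF obj]
  define N where "N = (\<lambda>(n, a). {y \<in> lim_pts S. (a, y n) \<in> path_edges (lev S n)})"
  have clN: "closedin (lim_top S) (N p)" for p
  proof (cases p)
    case (Pair n a)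
    have "closedin (lim_top S) {y \<in> topspace (lim_top S). y n \<in> {b. (a, b) \<in> path_edges (lev S n)}}"
      by (rule closedin_continuous_map_preimage[OF continuous_map_coord]) (auto simp: path_edges_def)
    then show ?thesis by (simp add: Pair N_def)
  qed
  have small: "\<exists>n. N (n, x n) \<subseteq> {y \<in> lim_pts S. quot_map S y \<in> U}"
    if x: "x \<in> lim_pts S" and U: "openin (quot_top S) U" "quot_map S x \<in> U" for x U
  proof (rule ccontr)
    let ?W = "{y \<in> lim_pts S. quot_map S y \<in> U}"
    assume neg: "\<not> ?thesis"
    have W: "openin (lim_top S) ?W" using U(1) by (simp add: openin_quot_top)
    have "(\<Inter>n. N (n, x n) - ?W) \<noteq> {}"
    proof (rule compact_space_imp_nest[OF comp])
      show "closedin (lim_top S) (N (n, x n) - ?W)" for n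
        by (rule closedin_diff[OF clN W])
      show "N (n, x n) - ?W \<noteq> {}" for n using neg by blast
      show "decseq (\<lambda>n. N (n, x n) - ?W)"
      proof (rule antimonoI)
        fix k n :: nat assume "k \<le> n"
        then show "N (n, x n) - ?W \<subseteq> N (k, x k) - ?W"
          using lim_pts_edge_mono[OF obj x] by (auto simp: N_def)
      qed
    qed
    then obtain y where y: "\<And>n. y \<in> N (n, x n)" "y \<notin> ?W" by auto
    then have "(x, y) \<in> lim_rel S" using x by (auto simp: N_def lim_rel_def)
    then have "quot_map S x = quot_map S y" "y \<in> lim_pts S"
      using quot_map_eq_iff[OF assms x] by (auto simp: lim_rel_def)
    then show False using y(2) U(2) by simp
  qed
  have "\<exists>f. continuous_map (quot_top S) (top_of_set {0..1::real}) f \<and>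
      (disjnt (quot_map S ` N p) (quot_map S ` N r) \<longrightarrow>
        f ` quot_map S ` N p \<subseteq> {0} \<and> f ` quot_map S ` N r \<subseteq> {1})" for p r
  proof (cases "disjnt (quot_map S ` N p) (quot_map S ` N r)")
    case True
    have "closedin (quot_top S) (quot_map S ` N p)" "closedin (quot_top S) (quot_map S ` N r)"
      using closed_map_quot_map[OF assms] clN unfolding closed_map_def by blast+
    with True Hausdorff_quot_top(2)[OF assms] show ?thesis
      unfolding normal_space_iff_Urysohn by metis
  next
    case False
    then show ?thesis by (intro exI[of _ "\<lambda>_. 0"]) simp
  qed
  then obtain F where F: "\<And>p r. continuous_map (quot_top S) (top_of_set {0..1::real}) (F p r)"
    "\<And>p r. disjnt (quot_map S ` N p) (quot_map S ` N r) \<Longrightarrow>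
        F p r ` quot_map S ` N p \<subseteq> {0} \<and> F p r ` quot_map S ` N r \<subseteq> {1}"
    by metis
  define e where "e = (\<lambda>c (p, r). F p r c)"
  define Y where "Y = product_topology (\<lambda>_::(nat \<times> nat) \<times> nat \<times> nat. euclideanreal) UNIV"
  have "continuous_map (quot_top S) euclideanreal (F p r)" for p r
    using F(1)[of p r] by (simp add: continuous_map_in_subtopology)
  then have cont: "continuous_map (quot_top S) Y e"
    unfolding Y_def continuous_map_componentwise_UNIV by (auto simp: e_def)
  have inj: "inj_on e (topspace (quot_top S))"
  proof (rule inj_onI, rule ccontr)
    fix c d assume cd: "c \<in> topspace (quot_top S)" "d \<in> topspace (quot_top S)"
      and ecd: "e c = e d" and "c \<noteq> d"
    obtain x y where x: "x \<in> lim_pts S" "c = quot_map S x" and y: "y \<in> lim_pts S" "d = quot_map S y"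
      using cd quot_map_image[of S] by (metis imageE topspace_quot_top)
    obtain U V where UV: "openin (quot_top S) U" "openin (quot_top S) V" "c \<in> U" "d \<in> V" "disjnt U V"
      using Hausdorff_quot_top(1)[OF assms] cd \<open>c \<noteq> d\<close> unfolding Hausdorff_space_def by metis
    obtain n where n: "N (n, x n) \<subseteq> {y \<in> lim_pts S. quot_map S y \<in> U}"
      using small[OF x(1) UV(1)] UV(3) x(2) by blast
    obtain k where k: "N (k, y k) \<subseteq> {y \<in> lim_pts S. quot_map S y \<in> V}"
      using small[OF y(1) UV(2)] UV(4) y(2) by blast
    have "disjnt (quot_map S ` N (n, x n)) (quot_map S ` N (k, y k))"
    proof -
      have "quot_map S ` N (n, x n) \<subseteq> U" "quot_map S ` N (k, y k) \<subseteq> V" using n k by auto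
      then show ?thesis using UV(5) unfolding disjnt_def by blast
    qed
    from F(2)[OF this] have *: "F (n, x n) (k, y k) ` quot_map S ` N (n, x n) \<subseteq> {0}"
      "F (n, x n) (k, y k) ` quot_map S ` N (k, y k) \<subseteq> {1}" by auto
    have "x \<in> N (n, x n)" "y \<in> N (k, y k)"
      using x(1) y(1) by (auto simp: N_def path_edges_def lim_pts_def)
    then have "F (n, x n) (k, y k) c = 0" "F (n, x n) (k, y k) d = 1"
      using * x(2) y(2) by auto
    then show False using fun_cong[OF ecd, of "((n, x n), (k, y k))"] by (simp add: e_def)
  qed
  have "Hausdorff_space Y" unfolding Y_def by (simp add: Hausdorff_space_product_topology)
  then have "embedding_map (quot_top S) Y e"
    using continuous_imp_embedding_map[OF cont compact_quot_top[OF obj]] inj by blast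
  then have "quot_top S homeomorphic_space subtopology Y (e ` topspace (quot_top S))"
    by (rule embedding_map_imp_homeomorphic_space)
  moreover have "metrizable_space (subtopology Y (e ` topspace (quot_top S)))"
    unfolding Y_def
    by (intro metrizable_space_subtopology)
       (simp add: metrizable_space_product_topology metrizable_space_euclidean)
  ultimately show ?thesis by (simp add: homeomorphic_metrizable_space)
qed

lemma topspace_Homeo_top:
  assumes "fraisse_limit S" "mtopology_of m = quot_top S"
  shows "topspace (Homeo_top (quot_top S) m) = Homeo (quot_top S)"
proof -
  have obj: "Komega_obj S" using assms by (simp add: fraisse_limit_def)
  have "h \<in> mspace (cfunspace (quot_top S) m)" if "h \<in> Homeo (quot_top S)" for h
  proof -
    have h: "continuous_map (quot_top S) (quot_top S) h" "h \<in> extensional (topspace (quot_top S))"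
      using that homeomorphic_imp_continuous_map by (auto simp: Homeo_def)
    have "compactin (mtopology_of m) (h ` topspace (quot_top S))"
      using compact_quot_top[OF obj] h(1) assms(2) by (simp add: compact_space_def image_compactin)
    then have "Metric_space.mbounded (mspace m) (mdist m) (h ` topspace (quot_top S))"
      using Metric_space.compactin_imp_mbounded[OF Metric_space_mspace_mdist]
      by (metis mtopology_of_def)
    moreover have "h ` topspace (quot_top S) \<subseteq> mspace m"
      using h(1) assms(2) by (metis continuous_map_image_subset_topspace topspace_mtopology_of)
    ultimately show ?thesis using h assms(2) by (auto simp: image_subset_iff)
  qed
  then show ?thesis unfolding Homeo_top_def by auto
qed

end

theory Submission
  imports Defs
begin

text \<open>
  Fix a homeomorphism \<open>h\<close> of the quotient and a level \<open>N\<close>.  By compactness two points whose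
  \<open>N\<close>-th coordinates are adjacent have close images in the quotient once \<open>N\<close> is large, so it
  suffices to find an automorphism \<open>f\<close> such that \<open>f x\<close> and \<open>y\<close> are adjacent at level \<open>N\<close>
  whenever \<open>y\<close> represents \<open>h\<close> of the class of \<open>x\<close> (\<open>homeo_approx_by_automorphism\<close>).  A Fraisse
  limit is homogeneous (\<open>fraisse_limit_homogeneous\<close>, a back-and-forth argument): every morphism
  onto level \<open>N\<close> that factors through a level \<open>M\<close> is the \<open>N\<close>-th coordinate of an automorphism.
  So only a single morphism \<open>lev S M \<rightarrow> lev S N\<close> that approximates \<open>h\<close> is needed.

  To find it, take a morphism \<open>p\<close> from the limit onto some finite path and record, for each
  vertex \<open>u\<close> of a fine level \<open>M\<close>, the values of \<open>p\<close> on \<open>h\<close> of the points lying over \<open>u\<close>.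
  By uniform continuity these values lie in a set \<open>{v, v + 1}\<close>, and the least one is a
  \<open>1\<close>-Lipschitz function of \<open>u\<close>.  There remains the shape of this function: it has to run
  monotonically back and forth between the two ends of the target path, with no turn in the
  middle.  The reason is confluence.  In a morphism of finite paths one can walk from any vertex
  to a zero without ever going up, and to the other extreme value without ever going down.  In
  topological terms, every component of the preimage of an end segment maps onto that segment;
  this property of \<open>p\<close> is invariant under homeomorphisms, and hence the recorded values inherit
  it (\<open>homeo_coarse_confluent\<close>).  A turn in the middle would violate it.  Since the values are
  known up to an error of \<open>1\<close> only, the conclusion is a zigzag after the last two values at each
  end have been identified (\<open>zigzag_coarse_confluent\<close>).

  Confluence does not tell at which end of the target path the zigzag starts, whereas a morphism
  has to start at \<open>0\<close>.  Therefore the target is not level \<open>N\<close> itself but a path of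
  twice its length, folded onto level \<open>N\<close> in the middle: the fold sends both ends to \<open>0\<close>.
\<close>


section \<open>Zigzags and monotone walks\<close>

text \<open>A zigzag is grown from left to right by pieces that are monotone and have both ends in
  \<open>{0, m}\<close>.  A piece with equal end values is constant and makes no step of a zigzag of its own:
  it is absorbed into the step before it, and as long as there is none, everything so far is constant.\<close>

lemma zigzag_or_const_snoc:
  assumes "zigzag f m a b \<or> (\<forall>v\<in>{a..b}. f v = f a)"
    and "a \<le> b" "b < c" and mono: "mono_on {b..c} f \<or> antimono_on {b..c} f"
    and ends: "f b \<in> {0, m}" "f c \<in> {0, m}"
  shows "zigzag f m a c \<or> (\<forall>v\<in>{a..c}. f v = f a)"
proof (cases "f c = f b")
  case True
  have bc: "f v = f b" if "v \<in> {b..c}" for v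
  proof -
    have "b \<in> {b..c}" "c \<in> {b..c}" "b \<le> v" "v \<le> c" using that \<open>b < c\<close> by auto
    then have "f b \<le> f v \<and> f v \<le> f c \<or> f c \<le> f v \<and> f v \<le> f b"
      using mono that unfolding monotone_on_def by blast
    then show ?thesis using True by linarith
  qed
  from assms(1) show ?thesis
  proof
    assume const: "\<forall>v\<in>{a..b}. f v = f a"
    have "f b = f a" using bspec[OF const, of b] \<open>a \<le> b\<close> by simp
    then have "f v = f a" if "v \<in> {a..c}" for v
      using bspec[OF const, of v] bc[of v] that by (cases "v \<le> b") auto
    then show ?thesis by blast
  next
    assume "zigzag f m a b"
    then show ?thesis
    proof cases
      case refl
      with bc show ?thesis by metis
    next
      case (step d)
      have cl: "f (min b v) = f v" if "v \<in> {d..c}" for v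
        using bc[of v] that by (cases "v \<le> b") (simp_all add: min_def)
      have "mono_on {d..c} f" if m: "mono_on {d..b} f"
      proof (rule monotone_onI)
        fix x y assume xy: "x \<in> {d..c}" "y \<in> {d..c}" "x \<le> y"
        then have "f (min b x) \<le> f (min b y)"
          using step(2) by (intro monotone_onD[OF m]) auto
        then show "f x \<le> f y" using cl xy by simp
      qed
      moreover have "antimono_on {d..c} f" if m: "antimono_on {d..b} f"
      proof (rule monotone_onI)
        fix x y assume xy: "x \<in> {d..c}" "y \<in> {d..c}" "x \<le> y"
        then have "f (min b x) \<ge> f (min b y)"
          using step(2) by (intro monotone_onD[OF m]) auto
        then show "f x \<ge> f y" using cl xy by simp
      qed
      ultimately have "mono_on {d..c} f \<or> antimono_on {d..c} f" using step by blast
      then show ?thesis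
        using zigzag.step[OF step(1), of c] step \<open>b < c\<close> True by simp
    qed
  qed
next
  case False
  then have flip: "f c = m - f b" using ends by auto
  from assms(1) show ?thesis
  proof
    assume "zigzag f m a b"
    then show ?thesis using zigzag.step[OF _ \<open>b < c\<close> mono flip] by blast
  next
    assume const: "\<forall>v\<in>{a..b}. f v = f a"
    then have fab: "f b = f a" using \<open>a \<le> b\<close> by (metis atLeastAtMost_iff order_refl)
    \<comment> \<open>On \<open>{a..c}\<close> the function is its restriction to \<open>{b..c}\<close> after a retraction.\<close>
    have cl: "f (max b v) = f v" if "v \<in> {a..c}" for v
      using bspec[OF const, of v] fab that by (auto simp: max_def)
    have "mono_on {a..c} f \<or> antimono_on {a..c} f"
      using mono
    proof
      assume m: "mono_on {b..c} f"
      have "mono_on {a..c} f"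
      proof (rule monotone_onI)
        fix x y assume xy: "x \<in> {a..c}" "y \<in> {a..c}" "x \<le> y"
        then have "f (max b x) \<le> f (max b y)"
          using \<open>b < c\<close> by (intro monotone_onD[OF m]) auto
        then show "f x \<le> f y" using cl xy by simp
      qed
      then show ?thesis ..
    next
      assume m: "antimono_on {b..c} f"
      have "antimono_on {a..c} f"
      proof (rule monotone_onI)
        fix x y assume xy: "x \<in> {a..c}" "y \<in> {a..c}" "x \<le> y"
        then have "f (max b x) \<ge> f (max b y)"
          using \<open>b < c\<close> by (intro monotone_onD[OF m]) auto
        then show "f x \<ge> f y" using cl xy by simp
      qed
      then show ?thesis ..
    qed
    moreover have "zigzag f m a a" using ends fab by (auto intro: zigzag.refl)
    ultimately show ?thesis
      using zigzag.step[of f m a a c] flip fab \<open>a \<le> b\<close> \<open>b < c\<close> by simp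
  qed
qed

text \<open>The function \<open>f\<close> one would like to know takes a value in \<open>{lo u, hi u}\<close> at \<open>u\<close>, a set with at
  most two elements.  The assumptions express confluence: descending walks end at \<open>0\<close> and ascending ones at the
  top value \<open>m + 2\<close>.  Between two neighbouring marked vertices (where \<open>lo\<close> is \<open>0\<close> or \<open>hi\<close> is
  \<open>m + 2\<close>) both walks have to leave through a marked vertex.  If the marks are of opposite kind,
  this makes \<open>lo\<close> monotone up to values in the top pair; if they are of the same kind, it confines \<open>f\<close> to
  \<open>{0, 1}\<close> or to \<open>{m + 1, m + 2}\<close>, and the truncation in the conclusion identifies
  the elements of each of these two pairs.\<close>

lemma zigzag_coarse_confluent:
  fixes lo hi :: "nat \<Rightarrow> nat"
  assumes close: "\<And>u. u \<le> L \<Longrightarrow> lo u \<le> hi u \<and> hi u \<le> Suc (lo u)"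
    and "0 < m"
    and down: "\<And>u. u \<le> L \<Longrightarrow> \<exists>z\<le>L. lo z = 0 \<and> (\<forall>v\<in>{min u z..max u z}. lo v \<le> lo u)"
    and up: "\<And>u. u \<le> L \<Longrightarrow> \<exists>t\<le>L. hi t = m + 2 \<and> (\<forall>v\<in>{min u t..max u t}. hi u \<le> hi v)"
  shows "zigzag (\<lambda>u. min (lo u - 1) m) m 0 L"
proof -
  define \<psi> where "\<psi> u = min (lo u - 1) m" for u
  define Z where "Z = {u. u \<le> L \<and> lo u = 0}"
  define T where "T = {u. u \<le> L \<and> hi u = m + 2}"
  define E where "E = insert 0 (insert L (Z \<union> T))"
  have Z: "hi u \<le> 1" "lo u = 0" "\<psi> u = 0" if "u \<in> Z" for u
    using that close[of u] by (auto simp: Z_def \<psi>_def)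
  have T: "m + 1 \<le> lo u" "\<psi> u = m" if "u \<in> T" for u
    using that close[of u] by (auto simp: T_def \<psi>_def)
  have gap: "(mono_on {b..c} \<psi> \<or> antimono_on {b..c} \<psi>) \<and> \<psi> b \<in> {0, m} \<and> \<psi> c \<in> {0, m}"
    if bc: "b \<in> E" "c \<in> E" "b < c" "{b<..<c} \<inter> E = {}" for b c
  proof -
    have cL: "c \<le> L" using bc by (auto simp: E_def Z_def T_def)
    \<comment> \<open>A walk from the gap to a mark passes one of the ends of the gap, and this end is marked;
      the ends \<open>0\<close> and \<open>L\<close> of the path, which may be unmarked, cannot be passed.\<close>
    have mark: "(b \<in> Z \<union> T \<and> w \<le> b) \<or> (c \<in> Z \<union> T \<and> c \<le> w)"
      if "w \<in> Z \<union> T" for w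
    proof -
      have "w \<in> E" "w \<le> L" using that by (auto simp: E_def Z_def T_def)
      then have "\<not> (b < w \<and> w < c)" using bc(4) by auto
      then consider "w < b" | "w = b" | "w = c" | "c < w" by linarith
      then show ?thesis using that bc cL \<open>w \<le> L\<close> by cases (auto simp: E_def)
    qed
    have lo: "(b \<in> Z \<union> T \<and> (\<forall>v\<in>{b..u}. lo v \<le> lo u)) \<or> (c \<in> Z \<union> T \<and> (\<forall>v\<in>{u..c}. lo v \<le> lo u))"
      if u: "u \<in> {b..c}" for u
    proof -
      obtain z where z: "z \<in> Z" "\<forall>v\<in>{min u z..max u z}. lo v \<le> lo u"
        using down[of u] u cL unfolding Z_def by auto
      then show ?thesis using mark[of z] u by auto
    qed
    have hi: "(b \<in> Z \<union> T \<and> (\<forall>v\<in>{b..u}. hi u \<le> hi v)) \<or> (c \<in> Z \<union> T \<and> (\<forall>v\<in>{u..c}. hi u \<le> hi v))"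
      if u: "u \<in> {b..c}" for u
    proof -
      obtain t where t: "t \<in> T" "\<forall>v\<in>{min u t..max u t}. hi u \<le> hi v"
        using up[of u] u cL unfolding T_def by auto
      then show ?thesis using mark[of t] u by auto
    qed
    have "Z \<inter> T = {}" using Z(2) T(1) by fastforce
    then consider "b \<notin> T" "c \<notin> T" | "b \<notin> Z" "c \<notin> Z" | "b \<in> Z" "c \<in> T" | "b \<in> T" "c \<in> Z"
      by blast
    then show ?thesis
    proof cases
      case 1
      have "\<psi> u = 0" if u: "u \<in> {b..c}" for u
      proof -
        have "b \<in> Z \<union> T \<and> hi u \<le> hi b \<or> c \<in> Z \<union> T \<and> hi u \<le> hi c"
          using hi[OF u] u by (meson atLeastAtMost_iff order_refl)
        then have "hi u \<le> 1" using 1 Z(1)[of b] Z(1)[of c] by auto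
        then show ?thesis using close[of u] u cL by (auto simp: \<psi>_def)
      qed
      then show ?thesis using bc by (auto simp: monotone_on_def)
    next
      case 2
      have "\<psi> u = m" if u: "u \<in> {b..c}" for u
      proof -
        have "b \<in> Z \<union> T \<and> lo b \<le> lo u \<or> c \<in> Z \<union> T \<and> lo c \<le> lo u"
          using lo[OF u] u by (meson atLeastAtMost_iff order_refl)
        then have "m + 1 \<le> lo u" using 2 T(1)[of b] T(1)[of c] by auto
        then show ?thesis by (auto simp: \<psi>_def)
      qed
      then show ?thesis using bc by (auto simp: monotone_on_def)
    next
      case 3
      have "mono_on {b..c} \<psi>"
      proof (rule monotone_onI)
        fix x y assume xy: "x \<in> {b..c}" "y \<in> {b..c}" "x \<le> y"
        have "lo x \<le> lo y \<or> lo c \<le> lo y"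
          using lo[OF xy(2)] xy by (meson atLeastAtMost_iff order_refl)
        then have "lo x \<le> lo y \<or> m + 1 \<le> lo y" using T(1)[OF 3(2)] by linarith
        then show "\<psi> x \<le> \<psi> y" by (auto simp: \<psi>_def)
      qed
      then show ?thesis using Z(3)[OF 3(1)] T(2)[OF 3(2)] by auto
    next
      case 4
      have "antimono_on {b..c} \<psi>"
      proof (rule monotone_onI)
        fix x y assume xy: "x \<in> {b..c}" "y \<in> {b..c}" "x \<le> y"
        have "lo y \<le> lo x \<or> lo b \<le> lo x"
          using lo[OF xy(1)] xy by (meson atLeastAtMost_iff order_refl)
        then have "lo y \<le> lo x \<or> m + 1 \<le> lo x" using T(1)[OF 4(1)] by linarith
        then show "\<psi> y \<le> \<psi> x" by (auto simp: \<psi>_def)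
      qed
      then show ?thesis using Z(3)[OF 4(2)] T(2)[OF 4(1)] by auto
    qed
  qed
  have finE: "finite E" unfolding E_def Z_def T_def by simp
  obtain z t where zt: "z \<in> Z" "t \<in> T" using down[of 0] up[of 0] by (auto simp: Z_def T_def)
  have nonconst: "\<psi> z \<noteq> \<psi> t" using Z(3)[OF zt(1)] T(2)[OF zt(2)] \<open>0 < m\<close> by simp
  have chain: "zigzag \<psi> m 0 c \<or> (\<forall>v\<in>{0..c}. \<psi> v = \<psi> 0)" if "c \<in> E" for c
    using that
  proof (induction c rule: less_induct)
    case (less c)
    show ?case
    proof (cases "c = 0")
      case False
      define b where "b = Max {e \<in> E. e < c}"
      have fin: "finite {e \<in> E. e < c}" using finE by simp
      have "0 \<in> {e \<in> E. e < c}" using False by (simp add: E_def)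
      then have b: "b \<in> {e \<in> E. e < c}" unfolding b_def using fin by (intro Max_in) auto
      have "{b<..<c} \<inter> E = {}"
      proof -
        have "e \<le> b" if "e \<in> E" "e < c" for e
          unfolding b_def using that fin by (intro Max_ge) auto
        then show ?thesis by fastforce
      qed
      then have "(mono_on {b..c} \<psi> \<or> antimono_on {b..c} \<psi>) \<and> \<psi> b \<in> {0, m} \<and> \<psi> c \<in> {0, m}"
        using b less.prems by (intro gap) auto
      then show ?thesis
        using less.IH[of b] b by (intro zigzag_or_const_snoc[of \<psi> m 0 b c]) simp_all
    qed simp
  qed
  have "z \<le> L" "t \<le> L" using zt by (auto simp: Z_def T_def)
  then have "\<not> (\<forall>v\<in>{0..L}. \<psi> v = \<psi> 0)" using nonconst by (metis atLeastAtMost_iff le0)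
  then have "zigzag \<psi> m 0 L" using chain[of L] by (auto simp: E_def)
  then show ?thesis unfolding \<psi>_def .
qed

text \<open>On the monotone piece that contains \<open>e\<close>, one end has value \<open>0\<close> and the other has value \<open>m\<close>;
  the walks go straight to these ends.\<close>

lemma zigzag_walk:
  assumes "zigzag f m a b" "a < b" "e \<in> {a..b}"
  shows "\<exists>z\<in>{a..b}. f z = 0 \<and> (\<forall>v\<in>{min e z..max e z}. f v \<le> f e)"
    and "\<exists>t\<in>{a..b}. f t = m \<and> (\<forall>v\<in>{min e t..max e t}. f e \<le> f v)"
proof -
  have "(\<exists>z\<in>{a..b}. f z = 0 \<and> (\<forall>v\<in>{min e z..max e z}. f v \<le> f e)) \<and>
    (\<exists>t\<in>{a..b}. f t = m \<and> (\<forall>v\<in>{min e t..max e t}. f e \<le> f v))"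
    using assms
  proof (induction rule: zigzag.induct)
    case (step b c)
    have ab: "a \<le> b" "f b \<in> {0, m}" using zigzag_ends[OF step.hyps(1)] by auto
    show ?case
    proof (cases "e \<le> b \<and> a < b")
      case True
      then have IH: "(\<exists>z\<in>{a..b}. f z = 0 \<and> (\<forall>v\<in>{min e z..max e z}. f v \<le> f e)) \<and>
        (\<exists>t\<in>{a..b}. f t = m \<and> (\<forall>v\<in>{min e t..max e t}. f e \<le> f v))"
        using step.prems by (intro step.IH) auto
      have "{a..b} \<subseteq> {a..c}" using step.hyps by auto
      then show ?thesis using IH by blast
    next
      case False
      then have e: "e \<in> {b..c}" using step.prems ab by auto
      have fc: "f c = m - f b" by fact
      have *: "(\<forall>v\<in>{min e b..max e b}. f v \<le> f e) \<and> (\<forall>v\<in>{min e c..max e c}. f e \<le> f v)"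
        if "mono_on {b..c} f"
        using e step.hyps(2) by (auto simp: min_def max_def intro!: monotone_onD[OF that])
      have **: "(\<forall>v\<in>{min e b..max e b}. f e \<le> f v) \<and> (\<forall>v\<in>{min e c..max e c}. f v \<le> f e)"
        if "antimono_on {b..c} f"
        using e step.hyps(2) by (auto simp: min_def max_def intro!: monotone_onD[OF that])
      have mem: "b \<in> {a..c}" "c \<in> {a..c}" using ab step.hyps by auto
      show ?thesis
      proof (cases "mono_on {b..c} f")
        case True
        then have "f b \<le> f c" by (rule monotone_onD) (use step.hyps in auto)
        then have "f b = 0" "f c = m" using ab fc by auto
        then show ?thesis using *[OF True] mem by blast
      next
        case False
        then have am: "antimono_on {b..c} f" using step.hyps(3) by blast
        then have "f c \<le> f b" by (rule monotone_onD) (use step.hyps in auto)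
        then have "f b = m" "f c = 0" using ab fc by auto
        then show ?thesis using **[OF am] mem by blast
      qed
    qed
  qed simp
  then show "\<exists>z\<in>{a..b}. f z = 0 \<and> (\<forall>v\<in>{min e z..max e z}. f v \<le> f e)"
    "\<exists>t\<in>{a..b}. f t = m \<and> (\<forall>v\<in>{min e t..max e t}. f e \<le> f v)" by blast+
qed

lemma K_mor_walk:
  assumes "K_mor n b r" "2 \<le> n" "e < n"
  shows "\<exists>z<n. r z = 0 \<and> (\<forall>v\<in>{min e z..max e z}. r v \<le> r e)"
    and "\<exists>t<n. r t = b - 1 \<and> (\<forall>v\<in>{min e t..max e t}. r e \<le> r v)"
proof -
  have z: "zigzag r (b - 1) 0 (n - 1)" using assms(1) by (simp add: K_mor_alt)
  have "0 < n - 1" "e \<in> {0..n - 1}" using assms by auto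
  note walks = zigzag_walk[OF z this]
  have lt: "v < n" if "v \<in> {0..n - 1}" for v using that assms(2) by auto
  show "\<exists>z<n. r z = 0 \<and> (\<forall>v\<in>{min e z..max e z}. r v \<le> r e)" using walks(1) lt by blast
  show "\<exists>t<n. r t = b - 1 \<and> (\<forall>v\<in>{min e t..max e t}. r e \<le> r v)" using walks(2) lt by blast
qed

section \<open>Some morphisms of finite paths\<close>

text \<open>Surjectivity on edges is automatic for \<open>1\<close>-Lipschitz surjections: if the edge between \<open>a\<close> and
  \<open>a + 1\<close> were missed, no step could cross from \<open>{..a}\<close> to its complement.\<close>

lemma lipschitz_onto_edges:
  fixes f :: "nat \<Rightarrow> nat"
  assumes onto: "f ` {..<n} = {..<m}"
    and lip: "\<And>j. Suc j < n \<Longrightarrow> \<bar>int (f (Suc j)) - int (f j)\<bar> \<le> 1"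
  shows "map_prod f f ` path_edges n = path_edges m"
proof
  show "map_prod f f ` path_edges n \<subseteq> path_edges m"
  proof clarsimp
    fix a b assume ab: "(a, b) \<in> path_edges n"
    then have "f a < m" "f b < m" using onto by (auto simp: path_edges_def)
    moreover have "a = b \<or> b = Suc a \<or> a = Suc b" using ab by (auto simp: path_edges_def)
    then have "\<bar>int (f a) - int (f b)\<bar> \<le> 1"
      using ab lip[of a] lip[of b] by (auto simp: path_edges_def abs_minus_commute)
    ultimately show "(f a, f b) \<in> path_edges m" by (simp add: path_edges_def)
  qed
  have up: "\<exists>u v. (u, v) \<in> path_edges n \<and> f u = a \<and> f v = Suc a" if "Suc a < m" for a
  proof (rule ccontr)
    assume neg: "\<not> ?thesis"
    have const: "f w \<le> a \<longleftrightarrow> f 0 \<le> a" if "w < n" for w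
      using that
    proof (induction w)
      case (Suc w)
      have "(w, Suc w) \<in> path_edges n" "(Suc w, w) \<in> path_edges n"
        using Suc.prems by (auto simp: path_edges_def)
      then have "\<not> (f w = a \<and> f (Suc w) = Suc a)" "\<not> (f (Suc w) = a \<and> f w = Suc a)"
        using neg by blast+
      then have "f (Suc w) \<le> a \<longleftrightarrow> f w \<le> a" using lip[OF Suc.prems] by linarith
      then show ?case using Suc by simp
    qed simp
    have "a \<in> f ` {..<n}" "Suc a \<in> f ` {..<n}" using onto that by auto
    then obtain u v where "u < n" "f u = a" "v < n" "f v = Suc a" by auto
    then show False using const[of u] const[of v] by simp
  qed
  show "path_edges m \<subseteq> map_prod f f ` path_edges n"
  proof clarsimp
    fix a b assume ab: "(a, b) \<in> path_edges m"
    then consider "a = b" | "b = Suc a" | "a = Suc b" by (fastforce simp: path_edges_def)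
    then show "(a, b) \<in> map_prod f f ` path_edges n"
    proof cases
      case 1
      then have "a \<in> f ` {..<n}" using ab onto by (auto simp: path_edges_def)
      then obtain u where "u < n" "f u = a" by auto
      then show ?thesis
        using 1 by (intro image_eqI[of _ _ "(u, u)"]) (auto simp: path_edges_def)
    next
      case 2
      then obtain u v where "(u, v) \<in> path_edges n" "f u = a" "f v = b"
        using up[of a] ab by (auto simp: path_edges_def)
      then show ?thesis by (intro image_eqI[of _ _ "(u, v)"]) auto
    next
      case 3
      then obtain u v where "(u, v) \<in> path_edges n" "f u = b" "f v = a"
        using up[of b] ab by (auto simp: path_edges_def)
      then show ?thesis
        by (intro image_eqI[of _ _ "(v, u)"]) (auto simp: path_edges_def abs_minus_commute)
    qed
  qed
qed

lemma K_mor_clamp: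
  assumes "0 < m"
  shows "K_mor (m + 3) (m + 1) (\<lambda>v. min (v - 1) m)"
proof -
  let ?f = "\<lambda>v. min (v - 1) m"
  have onto: "?f ` {..<m + 3} = {..<m + 1}"
  proof
    show "{..<m + 1} \<subseteq> ?f ` {..<m + 3}"
    proof
      fix v assume "v \<in> {..<m + 1}"
      then show "v \<in> ?f ` {..<m + 3}" by (intro image_eqI[of _ _ "v + 1"]) auto
    qed
  qed auto
  have "map_prod ?f ?f ` path_edges (m + 3) = path_edges (m + 1)"
    by (rule lipschitz_onto_edges[OF onto]) auto
  moreover have "zigzag ?f m 0 (m + 2)"
    by (rule zigzag.step[OF zigzag.refl]) (auto simp: monotone_on_def)
  ultimately show ?thesis using onto by (simp add: K_mor_alt path_epi_def)
qed

text \<open>The fold of a path in the middle; both ends are sent to \<open>0\<close>.\<close>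

lemma K_mor_tent:
  assumes "2 \<le> n"
  shows "K_mor (2 * n) n (\<lambda>v. min v (2 * n - 1 - v))"
proof -
  let ?f = "\<lambda>v. min v (2 * n - 1 - v)"
  have onto: "?f ` {..<2 * n} = {..<n}"
  proof
    show "{..<n} \<subseteq> ?f ` {..<2 * n}"
    proof
      fix v assume "v \<in> {..<n}"
      then show "v \<in> ?f ` {..<2 * n}" by (intro image_eqI[of _ _ v]) auto
    qed
  qed auto
  have "map_prod ?f ?f ` path_edges (2 * n) = path_edges n"
    by (rule lipschitz_onto_edges[OF onto]) auto
  moreover have "zigzag ?f (n - 1) 0 (n - 1)"
    by (rule zigzag.step[OF zigzag.refl]) (use assms in \<open>auto simp: monotone_on_def\<close>)
  then have "zigzag ?f (n - 1) 0 (2 * n - 1)"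
    by (rule zigzag.step) (use assms in \<open>auto simp: monotone_on_def\<close>)
  ultimately show ?thesis using onto by (simp add: K_mor_alt path_epi_def)
qed

text \<open>A zigzag may start at either end; after composition with a morphism that sends both ends to \<open>0\<close>
  the zero-vertex is preserved.\<close>

lemma K_mor_comp_free_start:
  assumes f: "zigzag f m 0 (n - 1)" "0 < m" "f ` {..<n} = {..<m + 1}"
    and lip: "\<And>j. Suc j < n \<Longrightarrow> \<bar>int (f (Suc j)) - int (f j)\<bar> \<le> 1"
    and g: "K_mor (m + 1) l g" "g m = 0"
  shows "K_mor n l (g \<circ> f)"
proof -
  have gg: "g ` {..<m + 1} = {..<l}" "map_prod g g ` path_edges (m + 1) = path_edges l" "g 0 = 0"
    "zigzag g (l - 1) 0 m"
    using g(1) by (auto simp: K_mor_alt path_epi_def)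
  have "zigzag (g \<circ> f) (l - 1) 0 (n - 1)"
    using f(1,2) gg(4) lip by (rule zigzag_comp) simp
  moreover have "(g \<circ> f) ` {..<n} = {..<l}" using f(3) gg(1) by (simp only: image_comp[symmetric])
  moreover have "map_prod (g \<circ> f) (g \<circ> f) ` path_edges n = path_edges l"
    using lipschitz_onto_edges[OF f(3) lip] gg(2)
    by (simp only: image_comp[symmetric] map_prod.comp[symmetric])
  moreover have "(g \<circ> f) 0 = 0" using zigzag_ends[OF f(1)] gg(3) g(2) by auto
  ultimately show ?thesis by (simp add: K_mor_alt path_epi_def)
qed

section \<open>Homogeneity of the Fraisse limit\<close>

lemma lim_pts_coord_surj:
  assumes "Komega_obj S" "u < lev S n"
  shows "\<exists>x\<in>lim_pts S. x n = u"
proof -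
  have K: "K_mor (lev S (Suc k)) (lev S k) (bond S k)" for k
    using assms(1) by (simp add: Komega_obj_def)
  have "\<exists>w. w n = u \<and> (\<forall>j<n. w j < lev S j \<and> bond S j (w (Suc j)) = w j)"
    using assms(2)
  proof (induction n arbitrary: u)
    case (Suc n)
    obtain w where w: "w n = bond S n u" "\<forall>j<n. w j < lev S j \<and> bond S j (w (Suc j)) = w j"
      using Suc.IH[OF K_mor_lt[OF K Suc.prems]] by blast
    then show ?case
      using K_mor_lt[OF K Suc.prems]
      by (intro exI[of _ "w(Suc n := u)"]) (auto simp: less_Suc_eq)
  qed auto
  then obtain w where w: "w n = u" "\<And>j. j < n \<Longrightarrow> w j < lev S j \<and> bond S j (w (Suc j)) = w j"
    by blast
  have "\<exists>z. z 0 = u \<and> (\<forall>k. z k < lev S (n + k) \<and> bond S (n + k) (z (Suc k)) = z k)"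
  proof -
    have "\<exists>z. \<forall>k. (z k < lev S (n + k) \<and> (k = 0 \<longrightarrow> z k = u)) \<and> bond S (n + k) (z (Suc k)) = z k"
    proof (rule dependent_nat_choice)
      fix v k assume "v < lev S (n + k) \<and> (k = 0 \<longrightarrow> v = u)"
      moreover have "bond S (n + k) ` {..<lev S (Suc (n + k))} = {..<lev S (n + k)}"
        using K by (simp add: K_mor_def path_epi_def)
      ultimately obtain v' where "v' < lev S (Suc (n + k))" "bond S (n + k) v' = v"
        by (metis imageE lessThan_iff)
      then show "\<exists>v'. (v' < lev S (n + Suc k) \<and> (Suc k = 0 \<longrightarrow> v' = u)) \<and> bond S (n + k) v' = v"
        by auto
    qed (use assms(2) in auto)
    then show ?thesis by blast
  qed
  then obtain z where z: "z 0 = u" "\<And>k. z k < lev S (n + k)" "\<And>k. bond S (n + k) (z (Suc k)) = z k"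
    by blast
  define x where "x j = (if j < n then w j else z (j - n))" for j
  have "x j < lev S j \<and> bond S j (x (Suc j)) = x j" for j
  proof -
    consider "Suc j < n" | "Suc j = n" | "n \<le> j" by linarith
    then show ?thesis
    proof cases
      case 1 then show ?thesis using w(2)[of j] by (simp add: x_def)
    next
      case 2 then show ?thesis using w(2)[of j] w(1) z(1) by (auto simp: x_def)
    next
      case 3 then show ?thesis using z(2,3)[of "j - n"] by (simp add: x_def Suc_diff_le)
    qed
  qed
  then show ?thesis using z(1) by (intro bexI[of _ x]) (auto simp: x_def lim_pts_def)
qed

text \<open>The composites of bonding maps, described by their effect on the points of the limit.\<close>

lemma K_mor_proj:
  assumes "Komega_obj S" "i \<le> j"
  shows "\<exists>\<beta>. K_mor (lev S j) (lev S i) \<beta> \<and> (\<forall>x\<in>lim_pts S. \<beta> (x j) = x i)"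
  using assms(2)
proof (induction j rule: dec_induct)
  case base
  show ?case using assms(1) by (intro exI[of _ "\<lambda>v. v"]) (simp add: K_mor_id Komega_obj_def)
next
  case (step j)
  then obtain \<beta> where \<beta>: "K_mor (lev S j) (lev S i) \<beta>" "\<forall>x\<in>lim_pts S. \<beta> (x j) = x i" by blast
  have "K_mor (lev S (Suc j)) (lev S i) (\<beta> \<circ> bond S j)"
    using assms(1) by (intro K_mor_comp[OF _ \<beta>(1)]) (simp_all add: Komega_obj_def)
  moreover have "(\<beta> \<circ> bond S j) (x (Suc j)) = x i" if "x \<in> lim_pts S" for x
    using \<beta>(2) that by (simp add: lim_pts_def)
  ultimately show ?case by blast
qed

text \<open>The extension property, read at finite levels: the projection to level \<open>j\<close> lifts along \<open>\<alpha>\<close>,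
  and the lift factors through a level \<open>k\<close>, which can be taken as large as desired.\<close>

lemma fraisse_limit_lift:
  assumes "fraisse_limit S" "2 \<le> b" and \<alpha>: "K_mor b (lev S j) \<alpha>"
  shows "\<exists>k>K0. \<exists>\<beta>. K_mor (lev S k) b \<beta> \<and> (\<forall>x\<in>lim_pts S. \<alpha> (\<beta> (x k)) = x j)"
proof -
  have obj: "Komega_obj S" using assms(1) by (simp add: fraisse_limit_def)
  define p where "p = (\<lambda>x\<in>lim_pts S. \<lambda>_::nat. x j)"
  define g where "g = (\<lambda>x\<in>lim_pts (const_seq b). \<lambda>n::nat. \<alpha> (x n))"
  have "2 \<le> lev S j" using obj by (simp add: Komega_obj_def)
  moreover have "p \<in> Komega_hom S (const_seq (lev S j))"
    unfolding p_def by (rule Komega_hom_proj[OF obj])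
  moreover have "g \<in> Komega_hom (const_seq b) (const_seq (lev S j))"
    unfolding g_def by (rule Komega_hom_const[OF \<alpha>])
  ultimately obtain h where h: "h \<in> Komega_hom S (const_seq b)" "\<And>x. x \<in> lim_pts S \<Longrightarrow> g (h x) = p x"
    using assms(1,2) unfolding fraisse_limit_def by metis
  obtain i \<phi> where \<phi>: "\<And>n. K_mor (lev S (i n)) b (\<phi> n)"
    "\<And>n x. x \<in> lim_pts S \<Longrightarrow> h x n = \<phi> n (x (i n))"
    using h(1) unfolding Komega_hom_def const_seq_def by auto metis
  define k where "k = max (Suc K0) (i 0)"
  obtain \<rho> where \<rho>: "K_mor (lev S k) (lev S (i 0)) \<rho>" "\<forall>x\<in>lim_pts S. \<rho> (x k) = x (i 0)"
    using K_mor_proj[OF obj, of "i 0" k] by (auto simp: k_def)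
  have "\<alpha> (\<phi> 0 (\<rho> (x k))) = x j" if x: "x \<in> lim_pts S" for x
    using fun_cong[OF h(2)[OF x], of 0] Komega_hom_mem[OF h(1) x] \<phi>(2)[OF x] \<rho>(2) x
    by (simp add: g_def p_def)
  moreover have "K_mor (lev S k) b (\<phi> 0 \<circ> \<rho>)"
    using obj by (intro K_mor_comp[OF \<rho>(1) \<phi>(1)]) (simp add: Komega_obj_def)
  moreover have "K0 < k" by (simp add: k_def)
  ultimately show ?thesis by (metis comp_apply)
qed

lemma lim_pts_eqI:
  assumes "Komega_obj S" "x \<in> lim_pts S" "y \<in> lim_pts S"
    and "\<And>n::nat. n \<le> a n" "\<And>n. x (a n) = y (a n)"
  shows "x = y"
proof
  fix n
  obtain \<rho> where "\<forall>x\<in>lim_pts S. \<rho> (x (a n)) = x n"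
    using K_mor_proj[OF assms(1) assms(4)] by blast
  then show "x n = y n" using assms by metis
qed

text \<open>Compatible morphisms into a cofinal sequence of levels of \<open>T\<close> define a morphism into \<open>T\<close>.
  Compatibility of neighbouring rungs is expressed by a point of the limit that realizes both values,
  which avoids any mention of composite bonding maps.\<close>

lemma Komega_hom_of_ladder:
  assumes obj: "Komega_obj S" "Komega_obj T" and ab: "strict_mono a" "strict_mono b"
    and \<alpha>: "\<And>k. K_mor (lev S (b k)) (lev T (a k)) (\<alpha> k)"
    and compat: "\<And>k x. x \<in> lim_pts S \<Longrightarrow>
      \<exists>y\<in>lim_pts T. y (a (Suc k)) = \<alpha> (Suc k) (x (b (Suc k))) \<and> y (a k) = \<alpha> k (x (b k))"
  shows "\<exists>f\<in>Komega_hom S T. \<forall>x\<in>lim_pts S. \<forall>k. f x (a k) = \<alpha> k (x (b k))"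
proof -
  have le: "n \<le> a n" for n using ab(1) by (rule strict_mono_imp_increasing)
  obtain \<rho> where \<rho>: "\<And>i j. i \<le> j \<Longrightarrow> K_mor (lev T j) (lev T i) (\<rho> i j)"
    "\<And>i j y. i \<le> j \<Longrightarrow> y \<in> lim_pts T \<Longrightarrow> \<rho> i j (y j) = y i"
    using K_mor_proj[OF obj(2)] by metis
  define f where "f = (\<lambda>x\<in>lim_pts S. \<lambda>n. \<rho> n (a n) (\<alpha> n (x (b n))))"
  have down: "\<rho> n (a l) (\<alpha> l (x (b l))) = \<rho> n (a k) (\<alpha> k (x (b k)))"
    if x: "x \<in> lim_pts S" and "n \<le> a k" "k \<le> l" for x n k l
    using \<open>k \<le> l\<close>
  proof (induction l rule: dec_induct)
    case (step l)
    obtain y where y: "y \<in> lim_pts T" "y (a (Suc l)) = \<alpha> (Suc l) (x (b (Suc l)))" "y (a l) = \<alpha> l (x (b l))"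
      using compat[OF x] by blast
    have "a k \<le> a l" "a l \<le> a (Suc l)"
      using step.hyps ab(1) by (auto simp: strict_mono_less_eq)
    then have "\<rho> n (a (Suc l)) (y (a (Suc l))) = \<rho> n (a l) (y (a l))"
      using \<open>n \<le> a k\<close> \<rho>(2)[OF _ y(1)] by (metis order_trans)
    then show ?case using step.IH y by simp
  qed simp
  have lift: "\<exists>y\<in>lim_pts T. y (a k) = \<alpha> k (x (b k))" if "x \<in> lim_pts S" for x k
    using lim_pts_coord_surj[OF obj(2)] K_mor_lt[OF \<alpha>] that by (auto simp: lim_pts_def)
  have val: "f x (a k) = \<alpha> k (x (b k))" if x: "x \<in> lim_pts S" for x k
  proof -
    obtain y where y: "y \<in> lim_pts T" "y (a k) = \<alpha> k (x (b k))" using lift[OF x] by blast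
    have "k \<le> a k" by (rule le)
    have "f x (a k) = \<rho> (a k) (a k) (\<alpha> k (x (b k)))"
      using down[OF x order_refl \<open>k \<le> a k\<close>] le x by (simp add: f_def)
    also have "\<dots> = \<alpha> k (x (b k))" using \<rho>(2)[OF order_refl y(1)] y(2) by metis
    finally show ?thesis .
  qed
  have mem: "f x \<in> lim_pts T" if x: "x \<in> lim_pts S" for x
  proof -
    have "f x n < lev T n \<and> bond T n (f x (Suc n)) = f x n" for n
    proof -
      obtain y where y: "y \<in> lim_pts T" "y (a (Suc n)) = \<alpha> (Suc n) (x (b (Suc n)))" "y (a n) = \<alpha> n (x (b n))"
        using compat[OF x] by blast
      have "f x n = y n" using \<rho>(2)[OF le y(1), of n] y(3) x by (simp add: f_def)
      moreover have "f x (Suc n) = y (Suc n)"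
        using \<rho>(2)[OF le y(1), of "Suc n"] y(2) x by (simp add: f_def)
      ultimately show ?thesis using y(1) by (simp add: lim_pts_def)
    qed
    then show ?thesis by (simp add: lim_pts_def)
  qed
  have "f \<in> Komega_hom S T"
    unfolding Komega_hom_def mem_Collect_eq
  proof (intro conjI exI allI ballI)
    show "f \<in> lim_pts S \<rightarrow>\<^sub>E lim_pts T" using mem by (auto simp: f_def)
    show "strict_mono b" by (rule ab)
    show "K_mor (lev S (b n)) (lev T n) (\<rho> n (a n) \<circ> \<alpha> n)" for n
      using obj(2) by (intro K_mor_comp[OF \<alpha> \<rho>(1)[OF le]]) (simp add: Komega_obj_def)
    show "f x n = (\<rho> n (a n) \<circ> \<alpha> n) (x (b n))" if "x \<in> lim_pts S" for x n
      using that by (simp add: f_def)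
  qed
  then show ?thesis using val by blast
qed

text \<open>Back and forth: repeated lifting, starting with \<open>\<alpha>\<close>, gives levels \<open>c 0 = N < c 1 = M < c 2 < \<dots>\<close> and
  morphisms \<open>\<gamma> k\<close> from level \<open>c (k + 1)\<close> to level \<open>c k\<close>, any two consecutive ones composing to the
  projection.  The even ones form a ladder for \<open>f\<close>, the odd ones a ladder for its inverse.\<close>

lemma fraisse_limit_homogeneous:
  assumes fl: "fraisse_limit S" and \<alpha>: "K_mor (lev S M) (lev S N) \<alpha>" and "N < M"
  shows "\<exists>f\<in>Komega_aut S. \<forall>x\<in>lim_pts S. f x N = \<alpha> (x M)"
proof -
  have obj: "Komega_obj S" using fl by (simp add: fraisse_limit_def)
  have lev2: "2 \<le> lev S n" for n using obj by (simp add: Komega_obj_def)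
  \<comment> \<open>A state of the construction is a triple \<open>(i, j, \<gamma>)\<close> with \<open>\<gamma>\<close> a morphism from level \<open>j\<close> to level \<open>i\<close>.\<close>
  define P where "P = (\<lambda>(k::nat) (i, j, \<gamma>). i < j \<and> K_mor (lev S j) (lev S i) \<gamma> \<and> (k = 0 \<longrightarrow> (i, j, \<gamma>) = (N, M, \<alpha>)))"
  define Q where "Q = (\<lambda>(k::nat) (i::nat, j::nat, \<gamma> :: nat \<Rightarrow> nat) (i', j'::nat, \<gamma>' :: nat \<Rightarrow> nat). i' = j \<and> (\<forall>x\<in>lim_pts S. \<gamma> (\<gamma>' (x j')) = (x i :: nat)))"
  have "\<exists>s. \<forall>k. P k (s k) \<and> Q k (s k) (s (Suc k))"
  proof (rule dependent_nat_choice)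
    show "\<exists>t. P 0 t" using \<alpha> \<open>N < M\<close> by (intro exI[of _ "(N, M, \<alpha>)"]) (simp add: P_def)
    show "\<exists>t'. P (Suc k) t' \<and> Q k t t'" if "P k t" for t k
    proof -
      obtain i j \<gamma> where t: "t = (i, j, \<gamma>)" by (cases t)
      have "i < j" "K_mor (lev S j) (lev S i) \<gamma>" using that by (auto simp: P_def t)
      from fraisse_limit_lift[OF fl lev2 this(2), of j]
      obtain j' \<gamma>' where "j < j'" "K_mor (lev S j') (lev S j) \<gamma>'" "\<forall>x\<in>lim_pts S. \<gamma> (\<gamma>' (x j')) = x i"
        by blast
      then show ?thesis by (intro exI[of _ "(j, j', \<gamma>')"]) (simp add: P_def Q_def t)
    qed
  qed
  then obtain s where s: "\<And>k. P k (s k)" "\<And>k. Q k (s k) (s (Suc k))" by blast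
  define c where "c = (\<lambda>k. fst (s k))"
  define \<gamma> where "\<gamma> = (\<lambda>k. snd (snd (s k)))"
  have c_Suc: "fst (snd (s k)) = c (Suc k)" for k
    using s(2)[of k] by (simp add: Q_def c_def split: prod.splits)
  have c_less: "c k < c (Suc k)" and \<gamma>: "K_mor (lev S (c (Suc k))) (lev S (c k)) (\<gamma> k)" for k
    using s(1)[of k] c_Suc[of k] by (auto simp: P_def c_def \<gamma>_def split: prod.splits)
  have \<gamma>\<gamma>: "\<gamma> k (\<gamma> (Suc k) (x (c (Suc (Suc k))))) = x (c k)" if "x \<in> lim_pts S" for x k
    using s(2)[of k] c_Suc[of "Suc k"] that by (auto simp: Q_def c_def \<gamma>_def split: prod.splits)
  have s0: "s 0 = (N, M, \<alpha>)" using s(1)[of 0] by (auto simp: P_def split: prod.splits)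
  then have init: "c 0 = N" "c 1 = M" "\<gamma> 0 = \<alpha>"
    using c_Suc[of 0] by (auto simp: c_def \<gamma>_def)
  have mono: "strict_mono c" using c_less by (simp add: strict_mono_Suc_iff)
  \<comment> \<open>The offset \<open>d\<close> is \<open>0\<close> for the automorphism and \<open>1\<close> for its inverse.\<close>
  have ladder: "\<exists>f\<in>Komega_hom S S. \<forall>x\<in>lim_pts S. \<forall>k. f x (c (2 * k + d)) = \<gamma> (2 * k + d) (x (c (2 * k + d + 1)))" for d
  proof (rule Komega_hom_of_ladder[OF obj obj, of "\<lambda>k. c (2 * k + d)" "\<lambda>k. c (2 * k + d + 1)"])
    show "strict_mono (\<lambda>k. c (2 * k + d))" "strict_mono (\<lambda>k. c (2 * k + d + 1))"
      using mono by (auto simp: strict_mono_def)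
    show "K_mor (lev S (c (2 * k + d + 1))) (lev S (c (2 * k + d))) (\<gamma> (2 * k + d))" for k
      using \<gamma> by simp
    fix k x assume x: "x \<in> lim_pts S"
    define e where "e = 2 * k + d"
    have "\<gamma> (e + 2) (x (c (e + 3))) < lev S (c (e + 2))"
      using x K_mor_lt[OF \<gamma>[of "e + 2"], of "x (c (e + 3))"] by (simp add: lim_pts_def numeral_3_eq_3)
    then obtain y where y: "y \<in> lim_pts S" "y (c (e + 2)) = \<gamma> (e + 2) (x (c (e + 3)))"
      using lim_pts_coord_surj[OF obj] by blast
    have "y (c e) = \<gamma> e (\<gamma> (e + 1) (y (c (e + 2))))" using \<gamma>\<gamma>[OF y(1), of e] by simp
    also have "\<dots> = \<gamma> e (x (c (e + 1)))"
      using \<gamma>\<gamma>[OF x, of "e + 1"] y(2) by (simp add: numeral_3_eq_3)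
    finally show "\<exists>y\<in>lim_pts S. y (c (2 * Suc k + d)) = \<gamma> (2 * Suc k + d) (x (c (2 * Suc k + d + 1))) \<and>
        y (c (2 * k + d)) = \<gamma> (2 * k + d) (x (c (2 * k + d + 1)))"
      using y by (intro bexI[of _ y]) (simp_all add: e_def numeral_3_eq_3)
  qed
  obtain f where f: "f \<in> Komega_hom S S"
    "\<And>x k. x \<in> lim_pts S \<Longrightarrow> f x (c (2 * k)) = \<gamma> (2 * k) (x (c (2 * k + 1)))"
    using ladder[of 0] by auto
  obtain g where g: "g \<in> Komega_hom S S"
    "\<And>x k. x \<in> lim_pts S \<Longrightarrow> g x (c (2 * k + 1)) = \<gamma> (2 * k + 1) (x (c (2 * k + 2)))"
    using ladder[of 1] by auto
  note fm = Komega_hom_mem[OF f(1)] and gm = Komega_hom_mem[OF g(1)]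
  have le: "n \<le> c (2 * n)" "n \<le> c (2 * n + 1)" for n
    using strict_mono_imp_increasing[OF mono, of "2 * n"]
      strict_mono_imp_increasing[OF mono, of "2 * n + 1"] by linarith+
  have "g (f x) = x" if x: "x \<in> lim_pts S" for x
  proof (rule lim_pts_eqI[OF obj gm[OF fm[OF x]] x le(2)])
    show "g (f x) (c (2 * n + 1)) = x (c (2 * n + 1))" for n
      using g(2)[OF fm[OF x], of n] f(2)[OF x, of "n + 1"] \<gamma>\<gamma>[OF x, of "2 * n + 1"]
      by (simp add: numeral_3_eq_3)
  qed
  moreover have "f (g x) = x" if x: "x \<in> lim_pts S" for x
  proof (rule lim_pts_eqI[OF obj fm[OF gm[OF x]] x le(1)])
    show "f (g x) (c (2 * n)) = x (c (2 * n))" for n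
      using f(2)[OF gm[OF x], of n] g(2)[OF x, of n] \<gamma>\<gamma>[OF x, of "2 * n"] by simp
  qed
  ultimately have "f \<in> Komega_aut S" using f(1) g(1) by (auto simp: Komega_aut_def)
  moreover have "f x N = \<alpha> (x M)" if "x \<in> lim_pts S" for x
    using f(2)[OF that, of 0] init by simp
  ultimately show ?thesis by blast
qed

section \<open>Uniformity of the levels\<close>

abbreviation lim_sq :: "inv_seq \<Rightarrow> ((nat \<Rightarrow> nat) \<times> (nat \<Rightarrow> nat)) topology"
  where "lim_sq S \<equiv> prod_topology (lim_top S) (lim_top S)"

lemma continuous_map_coord_pair:
  "continuous_map (lim_sq S) (discrete_topology ({..<lev S n} \<times> {..<lev S n}))
     (\<lambda>p. (fst p n, snd p n))"
proof -
  have "continuous_map (lim_sq S) (discrete_topology {..<lev S n}) (\<lambda>p. fst p n)"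
    "continuous_map (lim_sq S) (discrete_topology {..<lev S n}) (\<lambda>p. snd p n)"
    using continuous_map_compose[OF continuous_map_fst continuous_map_coord[of S n]]
      continuous_map_compose[OF continuous_map_snd continuous_map_coord[of S n]]
    by (simp_all add: o_def)
  then show ?thesis by (simp add: prod_topology_discrete_topology continuous_map_pairedI)
qed

lemma closedin_coord_pair:
  "closedin (lim_sq S) {p \<in> lim_pts S \<times> lim_pts S. (fst p n, snd p n) \<in> A}"
proof -
  have "closedin (lim_sq S) {p \<in> topspace (lim_sq S). (fst p n, snd p n) \<in> A \<inter> {..<lev S n} \<times> {..<lev S n}}"
    by (rule closedin_continuous_map_preimage[OF continuous_map_coord_pair]) auto
  also have "{p \<in> topspace (lim_sq S). (fst p n, snd p n) \<in> A \<inter> {..<lev S n} \<times> {..<lev S n}} =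
      {p \<in> lim_pts S \<times> lim_pts S. (fst p n, snd p n) \<in> A}"
    by (auto simp: lim_pts_def)
  finally show ?thesis .
qed

text \<open>The relation is the decreasing intersection of the compact sets of pairs that are adjacent at
  level \<open>n\<close>, so a compact set disjoint from it is disjoint from one of them.\<close>

lemma separated_from_lim_rel:
  assumes obj: "Komega_obj S" and cl: "closedin (lim_sq S) Q" and disj: "Q \<inter> lim_rel S = {}"
  shows "\<exists>N. \<forall>n\<ge>N. \<forall>(x, y)\<in>Q. (x n, y n) \<notin> path_edges (lev S n)"
proof -
  have Q: "Q \<subseteq> lim_pts S \<times> lim_pts S" using closedin_subset[OF cl] by simp
  define C where "C n = Q \<inter> {p \<in> lim_pts S \<times> lim_pts S. (fst p n, snd p n) \<in> path_edges (lev S n)}" for n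
  have anti: "C n \<subseteq> C k" if "k \<le> n" for k n
    using lim_pts_edge_mono[OF obj _ _ _ that] by (auto simp: C_def)
  have "\<exists>N. C N = {}"
  proof (rule ccontr)
    assume neg: "\<not> ?thesis"
    have "(\<Inter>n. C n) \<noteq> {}"
    proof (rule compact_space_imp_nest)
      show "compact_space (lim_sq S)"
        using compact_Hausdorff_lim_top(1)[OF obj] by (simp add: compact_space_prod_topology)
      show "closedin (lim_sq S) (C n)" for n
        unfolding C_def by (intro closedin_Int cl closedin_coord_pair)
      show "C n \<noteq> {}" for n using neg by blast
      show "decseq C" using anti by (intro antimonoI)
    qed
    then obtain x y where "\<And>n. (x, y) \<in> C n" by fast
    then have "(x, y) \<in> Q" "(x, y) \<in> lim_rel S" by (auto simp: C_def lim_rel_def)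
    then show False using disj by blast
  qed
  then obtain N where "C N = {}" by blast
  then have "C n = {}" if "n \<ge> N" for n using anti[OF that] by auto
  then show ?thesis using Q by (intro exI[of _ N]) (fastforce simp: C_def)
qed

lemma level_of_uniform_continuity:
  assumes obj: "Komega_obj S" and k: "continuous_map (lim_top S) (mtopology_of m) k"
    and resp: "\<And>x y. (x, y) \<in> lim_rel S \<Longrightarrow> k x = k y" and "0 < \<epsilon>"
  shows "\<exists>N. \<forall>n\<ge>N. \<forall>x\<in>lim_pts S. \<forall>y\<in>lim_pts S.
    (x n, y n) \<in> path_edges (lev S n) \<longrightarrow> mdist m (k x) (k y) < \<epsilon>"
proof -
  define Q where "Q = {p \<in> topspace (lim_sq S). mdist m (k (fst p)) (k (snd p)) \<in> {\<epsilon>..}}"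
  have kk: "continuous_map (lim_sq S) (mtopology_of m) (\<lambda>p. k (fst p))"
    "continuous_map (lim_sq S) (mtopology_of m) (\<lambda>p. k (snd p))"
    using continuous_map_compose[OF continuous_map_fst k] continuous_map_compose[OF continuous_map_snd k]
    by (simp_all add: o_def)
  have "closedin (lim_sq S) Q"
    unfolding Q_def by (rule closedin_continuous_map_preimage[OF continuous_map_mdist[OF kk]]) simp
  moreover have "Q \<inter> lim_rel S = {}"
  proof -
    have "k x \<in> mspace m" if "x \<in> lim_pts S" for x
      using continuous_map_image_subset_topspace[OF k] that by auto
    then have "mdist m (k x) (k y) = 0" if "(x, y) \<in> lim_rel S" for x y
      using resp[OF that] that by (simp add: lim_rel_def)
    then show ?thesis using \<open>0 < \<epsilon>\<close> by (fastforce simp: Q_def)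
  qed
  ultimately obtain N where N: "\<forall>n\<ge>N. \<forall>(x, y)\<in>Q. (x n, y n) \<notin> path_edges (lev S n)"
    using separated_from_lim_rel[OF obj] by blast
  show ?thesis
  proof (intro exI[of _ N] allI impI ballI)
    fix n x y
    assume "N \<le> n" "x \<in> lim_pts S" "y \<in> lim_pts S" "(x n, y n) \<in> path_edges (lev S n)"
    then have "(x, y) \<notin> Q" using N by blast
    then show "mdist m (k x) (k y) < \<epsilon>"
      using \<open>x \<in> lim_pts S\<close> \<open>y \<in> lim_pts S\<close> by (simp add: Q_def not_le)
  qed
qed

text \<open>Pairs that are not adjacent at level \<open>n\<close> form a compact set on which the distance of the classes
  does not vanish, so it has a positive lower bound there.\<close>

lemma quot_dist_of_level:
  assumes fl: "fraisse_limit S" and m: "mtopology_of m = quot_top S"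
  shows "\<exists>\<delta>>0. \<forall>x\<in>lim_pts S. \<forall>y\<in>lim_pts S.
    mdist m (quot_map S x) (quot_map S y) < \<delta> \<longrightarrow> (x n, y n) \<in> path_edges (lev S n)"
proof -
  have obj: "Komega_obj S" using fl by (simp add: fraisse_limit_def)
  have q: "continuous_map (lim_top S) (mtopology_of m) (quot_map S)"
    using quotient_imp_continuous_map[OF quotient_map_quot_map] m by simp
  have qq: "continuous_map (lim_sq S) (mtopology_of m) (\<lambda>p. quot_map S (fst p))"
    "continuous_map (lim_sq S) (mtopology_of m) (\<lambda>p. quot_map S (snd p))"
    using continuous_map_compose[OF continuous_map_fst q] continuous_map_compose[OF continuous_map_snd q]
    by (simp_all add: o_def)
  define Q where "Q = {p \<in> lim_pts S \<times> lim_pts S. (fst p n, snd p n) \<in> - path_edges (lev S n)}"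
  define d where "d p = mdist m (quot_map S (fst p)) (quot_map S (snd p))" for p
  have "compactin (lim_sq S) Q"
    unfolding Q_def using compact_Hausdorff_lim_top(1)[OF obj]
    by (intro closedin_compact_space closedin_coord_pair) (simp add: compact_space_prod_topology)
  moreover have "continuous_map (lim_sq S) euclideanreal d"
    unfolding d_def by (rule continuous_map_mdist[OF qq])
  ultimately have "compact (d ` Q)" using image_compactin by fastforce
  moreover have "0 \<notin> d ` Q"
  proof
    assume "0 \<in> d ` Q"
    then obtain x y where xy: "(x, y) \<in> Q" "d (x, y) = 0" by fastforce
    then have mem: "x \<in> lim_pts S" "y \<in> lim_pts S" by (auto simp: Q_def)
    have "quot_map S x \<in> mspace m" "quot_map S y \<in> mspace m"
      using continuous_map_image_subset_topspace[OF q] mem by auto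
    then have "quot_map S x = quot_map S y" using xy(2) by (simp add: d_def)
    then have "(x, y) \<in> lim_rel S" using quot_map_eq_iff[OF fl mem] by simp
    then show False using xy(1) by (simp add: Q_def lim_rel_def)
  qed
  ultimately obtain \<delta> where \<delta>: "\<delta> > 0" "\<forall>t\<in>d ` Q. \<delta> \<le> dist 0 t"
    using separate_point_closed[of "d ` Q" 0] compact_imp_closed by blast
  show ?thesis
  proof (intro exI[of _ \<delta>] conjI ballI impI)
    fix x y assume xy: "x \<in> lim_pts S" "y \<in> lim_pts S" "mdist m (quot_map S x) (quot_map S y) < \<delta>"
    have "(x, y) \<notin> Q"
    proof
      assume "(x, y) \<in> Q"
      then have "\<delta> \<le> dist 0 (d (x, y))" using \<delta>(2) by blast
      then show False using xy(3) by (simp add: d_def dist_real_def)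
    qed
    then show "(x n, y n) \<in> path_edges (lev S n)" using xy by (simp add: Q_def)
  qed (rule \<delta>)
qed

section \<open>Confluence\<close>

lemma nat_walk_induct:
  fixes e z :: nat
  assumes "P e"
    and step: "\<And>v v'. P v \<Longrightarrow> v \<in> {min e z..max e z} \<Longrightarrow> v' \<in> {min e z..max e z} \<Longrightarrow>
      \<bar>int v - int v'\<bar> \<le> 1 \<Longrightarrow> P v'"
  shows "P z"
proof -
  have "P v" if "v \<in> {min e z..max e z}" for v
    using that
  proof (induction "nat \<bar>int v - int e\<bar>" arbitrary: v)
    case 0
    then show ?case using \<open>P e\<close> by simp
  next
    case (Suc d)
    define w where "w = (if e < v then v - 1 else v + 1)"
    have w: "d = nat \<bar>int w - int e\<bar>" "w \<in> {min e z..max e z}" "\<bar>int w - int v\<bar> \<le> 1"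
      using Suc.hyps(2) Suc.prems unfolding w_def by (auto split: if_splits)
    show ?case using step[OF Suc.hyps(1)[OF w(1,2)] w(2) Suc.prems w(3)] .
  qed
  then show ?thesis by simp
qed

text \<open>The points over \<open>A\<close> form a closed set, and both the quotient map and \<open>h\<close> are closed maps.\<close>

lemma closedin_homeo_image:
  assumes fl: "fraisse_limit S" and h: "homeomorphic_map (quot_top S) (quot_top S) h"
  shows "closedin (lim_top S) {y \<in> lim_pts S. \<exists>x\<in>lim_pts S. x n \<in> A \<and> quot_map S y = h (quot_map S x)}"
proof -
  have "closedin (lim_top S) {x \<in> topspace (lim_top S). x n \<in> A \<inter> {..<lev S n}}"
    by (rule closedin_continuous_map_preimage[OF continuous_map_coord]) auto
  also have "{x \<in> topspace (lim_top S). x n \<in> A \<inter> {..<lev S n}} = {x \<in> lim_pts S. x n \<in> A}"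
    by (auto simp: lim_pts_def)
  finally have "closedin (quot_top S) (h ` quot_map S ` {x \<in> lim_pts S. x n \<in> A})"
    using closed_map_quot_map[OF fl] homeomorphic_imp_closed_map[OF h] unfolding closed_map_def by blast
  then have "closedin (lim_top S)
      {y \<in> topspace (lim_top S). quot_map S y \<in> h ` quot_map S ` {x \<in> lim_pts S. x n \<in> A}}"
    by (rule closedin_continuous_map_preimage[OF quotient_imp_continuous_map[OF quotient_map_quot_map]])
  also have "{y \<in> topspace (lim_top S). quot_map S y \<in> h ` quot_map S ` {x \<in> lim_pts S. x n \<in> A}} =
      {y \<in> lim_pts S. \<exists>x\<in>lim_pts S. x n \<in> A \<and> quot_map S y = h (quot_map S x)}"
    by auto
  finally show ?thesis .
qed

text \<open>Confluence is inherited from \<open>p\<close> by \<open>p \<circ> h\<close>.  Call a vertex of level \<open>M\<close> admissible if some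
  point over it is sent by \<open>h\<close> to a point with \<open>p\<close>-value in \<open>G\<close>, and let \<open>I\<close> be the component of
  \<open>x0 M\<close> among the admissible vertices.  Within the set of points with \<open>p\<close>-value in \<open>G\<close>, the image under \<open>h\<close> of
  the points over \<open>I\<close> and that of the points over the complement are closed, cover everything,
  and have no related points because \<open>I\<close> is a component and \<open>h\<close> is injective.  By compactness they
  are not even adjacent at some deep level \<open>L\<close>.  Hence a walk at level \<open>L\<close> inside \<open>G\<close>, from \<open>y0\<close> to
  a vertex with value \<open>c\<close>, cannot leave the first set, and its end point comes from a point over \<open>I\<close>.\<close>

lemma homeo_coarse_confluent:
  fixes G :: "nat set"
  assumes fl: "fraisse_limit S" and h: "homeomorphic_map (quot_top S) (quot_top S) h"
    and p: "K_mor (lev S N) b p"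
    and walk: "\<And>n r e. 2 \<le> n \<Longrightarrow> K_mor n b r \<Longrightarrow> e < n \<Longrightarrow> r e \<in> G \<Longrightarrow>
      \<exists>z<n. r z = c \<and> (\<forall>v\<in>{min e z..max e z}. r v \<in> G)"
    and x0: "x0 \<in> lim_pts S" and y0: "y0 \<in> lim_pts S" "quot_map S y0 = h (quot_map S x0)" "p (y0 N) \<in> G"
  shows "\<exists>x\<in>lim_pts S. \<exists>y\<in>lim_pts S. quot_map S y = h (quot_map S x) \<and> p (y N) = c \<and>
    (\<forall>v\<in>{min (x0 M) (x M)..max (x0 M) (x M)}.
      \<exists>x\<in>lim_pts S. \<exists>y\<in>lim_pts S. x M = v \<and> quot_map S y = h (quot_map S x) \<and> p (y N) \<in> G)"
proof -
  have obj: "Komega_obj S" using fl by (simp add: fraisse_limit_def)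
  define B where "B = {v. \<exists>x\<in>lim_pts S. \<exists>y\<in>lim_pts S. x M = v \<and> quot_map S y = h (quot_map S x) \<and> p (y N) \<in> G}"
  define I where "I = {v. {min (x0 M) v..max (x0 M) v} \<subseteq> B}"
  have x0I: "x0 M \<in> I" using x0 y0 by (auto simp: I_def B_def)
  have maximal: "v' \<in> I" if "v \<in> I" "v' \<in> B" "(v, v') \<in> path_edges (lev S M)" for v v'
  proof -
    have "{min (x0 M) v'..max (x0 M) v'} \<subseteq> insert v' {min (x0 M) v..max (x0 M) v}"
      using that(3) by (auto simp: path_edges_def)
    then show ?thesis using that by (auto simp: I_def)
  qed
  define W where "W A = {y \<in> lim_pts S. \<exists>x\<in>lim_pts S. x M \<in> A \<and> quot_map S y = h (quot_map S x)} \<inter>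
    {y \<in> lim_pts S. p (y N) \<in> G}" for A
  have cov: "y \<in> W I \<union> W (- I)" if y: "y \<in> lim_pts S" "p (y N) \<in> G" for y
  proof -
    have "quot_map S y \<in> h ` quot_map S ` lim_pts S"
      using y homeomorphic_imp_surjective_map[OF h] quot_map_image[of S] by auto
    then show ?thesis using y by (auto simp: W_def)
  qed
  have "W I \<times> W (- I) \<inter> lim_rel S = {}"
  proof -
    have False if yW: "y \<in> W I" "y' \<in> W (- I)" and R: "(y, y') \<in> lim_rel S" for y y'
    proof -
      have yy: "y \<in> lim_pts S" "y' \<in> lim_pts S" "p (y' N) \<in> G" using yW by (auto simp: W_def)
      obtain x where x: "x \<in> lim_pts S" "x M \<in> I" "quot_map S y = h (quot_map S x)"
        using yW(1) unfolding W_def by blast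
      obtain x' where x': "x' \<in> lim_pts S" "x' M \<notin> I" "quot_map S y' = h (quot_map S x')"
        using yW(2) unfolding W_def by blast
      have "quot_map S y = quot_map S y'" using quot_map_eq_iff[OF fl yy(1,2)] R by simp
      then have "quot_map S x = quot_map S x'"
        using x x' homeomorphic_imp_injective_map[OF h] quot_map_image[of S]
        by (metis imageI inj_on_def topspace_quot_top)
      then have "(x, x') \<in> lim_rel S" using quot_map_eq_iff[OF fl] x x' by blast
      then have "(x M, x' M) \<in> path_edges (lev S M)" by (simp add: lim_rel_def)
      moreover have "x' M \<in> B" using x' yy by (auto simp: B_def)
      ultimately show False using maximal x x' by blast
    qed
    then show ?thesis by blast
  qed
  moreover have "closedin (lim_sq S) (W I \<times> W (- I))"
  proof -
    have "closedin (lim_top S) {y \<in> topspace (lim_top S). y N \<in> {v. v < lev S N \<and> p v \<in> G}}"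
      by (rule closedin_continuous_map_preimage[OF continuous_map_coord]) auto
    moreover have "{y \<in> topspace (lim_top S). y N \<in> {v. v < lev S N \<and> p v \<in> G}} = {y \<in> lim_pts S. p (y N) \<in> G}"
      by (auto simp: lim_pts_def)
    ultimately have "closedin (lim_top S) (W A)" for A
      unfolding W_def by (intro closedin_Int closedin_homeo_image[OF fl h]) simp
    then show ?thesis by (simp add: closedin_prod_Times_iff)
  qed
  ultimately obtain L0 where L0: "\<forall>n\<ge>L0. \<forall>(y, y')\<in>W I \<times> W (- I). (y n, y' n) \<notin> path_edges (lev S n)"
    using separated_from_lim_rel[OF obj] by meson
  define L where "L = max L0 N"
  have sep: "(y L, y' L) \<notin> path_edges (lev S L)" if "y \<in> W I" "y' \<in> W (- I)" for y y'
    using L0 that by (auto simp: L_def)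
  obtain \<rho> where \<rho>: "K_mor (lev S L) (lev S N) \<rho>" "\<forall>x\<in>lim_pts S. \<rho> (x L) = x N"
    using K_mor_proj[OF obj, of N L] by (auto simp: L_def)
  define r where "r = p \<circ> \<rho>"
  have r: "K_mor (lev S L) b r"
    unfolding r_def using obj by (intro K_mor_comp[OF \<rho>(1) p]) (simp add: Komega_obj_def)
  have r_eq: "r (y L) = p (y N)" if "y \<in> lim_pts S" for y using \<rho>(2) that by (simp add: r_def)
  define e where "e = y0 L"
  have e: "e < lev S L" "r e \<in> G" using y0 r_eq[OF y0(1)] by (auto simp: e_def lim_pts_def)
  have "2 \<le> lev S L" using obj by (simp add: Komega_obj_def)
  from walk[OF this r e] obtain z
    where z: "z < lev S L" "r z = c" "\<And>v. v \<in> {min e z..max e z} \<Longrightarrow> r v \<in> G" by blast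
  \<comment> \<open>Since \<open>W I\<close> and \<open>W (- I)\<close> are separated at level \<open>L\<close>, over a good vertex all points with
    \<open>p\<close>-value in \<open>G\<close> lie in \<open>W I\<close>.\<close>
  define good where "good v \<longleftrightarrow> (\<exists>y\<in>W I. y L = v)" for v
  have y0W: "y0 \<in> W I" using x0 y0 x0I by (auto simp: W_def)
  then have "good e" by (auto simp: good_def e_def)
  have step: "good v'" if "good v" "(v, v') \<in> path_edges (lev S L)" "r v' \<in> G" for v v'
  proof -
    from that(1) obtain y where y: "y \<in> W I" "y L = v" by (auto simp: good_def)
    have "v' < lev S L" using that(2) by (simp add: path_edges_def)
    then obtain y' where y': "y' \<in> lim_pts S" "y' L = v'"
      using lim_pts_coord_surj[OF obj] by blast
    have "y' \<in> W I \<union> W (- I)" using cov[OF y'(1)] r_eq[OF y'(1)] y'(2) that(3) by simp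
    moreover have "y' \<notin> W (- I)" using sep[OF y(1), of y'] y(2) y'(2) that(2) by blast
    ultimately show ?thesis using y' by (auto simp: good_def)
  qed
  have "good z"
  proof (rule nat_walk_induct[of good e z])
    fix v v' assume v: "good v" "v \<in> {min e z..max e z}" "v' \<in> {min e z..max e z}" "\<bar>int v - int v'\<bar> \<le> 1"
    then have "(v, v') \<in> path_edges (lev S L)" using e(1) z(1) by (auto simp: path_edges_def)
    then show "good v'" using step v z(3) by blast
  qed fact
  then obtain y where y: "y \<in> W I" "y L = z" by (auto simp: good_def)
  then have ym: "y \<in> lim_pts S" by (simp add: W_def)
  obtain x where x: "x \<in> lim_pts S" "x M \<in> I" "quot_map S y = h (quot_map S x)"
    using y(1) unfolding W_def by blast
  have "p (y N) = c" using r_eq[OF ym] y(2) z(2) by simp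
  moreover have "\<forall>v\<in>{min (x0 M) (x M)..max (x0 M) (x M)}. v \<in> B" using x(2) by (auto simp: I_def)
  ultimately show ?thesis using x ym unfolding B_def by blast
qed

section \<open>Approximation of homeomorphisms\<close>

text \<open>The set \<open>A u\<close> consists of the values of \<open>p \<circ> h\<close> over the vertex \<open>u\<close>.  For a fine level \<open>M\<close> the
  values over adjacent vertices differ by at most \<open>1\<close>, so the minimum \<open>lo\<close> and the maximum \<open>hi\<close> of
  \<open>A u\<close> are as required by \<open>zigzag_coarse_confluent\<close>.  Confluence with \<open>G = {..lo u}\<close> gives the
  descending walks of \<open>lo\<close>, and with \<open>G = {hi u..}\<close> the ascending walks of \<open>hi\<close>; this is why both
  functions are needed.\<close>

lemma homeo_level_approximation:
  assumes fl: "fraisse_limit S" and m: "mtopology_of \<mu> = quot_top S"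
    and h: "homeomorphic_map (quot_top S) (quot_top S) h"
    and p: "K_mor (lev S N) (m + 3) p" and "0 < m"
  shows "\<exists>M>K0. \<exists>\<psi>. zigzag \<psi> m 0 (lev S M - 1) \<and> \<psi> ` {..<lev S M} = {..<m + 1} \<and>
    (\<forall>j. Suc j < lev S M \<longrightarrow> \<bar>int (\<psi> (Suc j)) - int (\<psi> j)\<bar> \<le> 1) \<and>
    (\<forall>x\<in>lim_pts S. \<forall>y\<in>lim_pts S. quot_map S y = h (quot_map S x) \<longrightarrow>
      \<bar>int (\<psi> (x M)) - int (min (p (y N) - 1) m)\<bar> \<le> 1)"
proof -
  have obj: "Komega_obj S" using fl by (simp add: fraisse_limit_def)
  have hsurj: "\<exists>y\<in>lim_pts S. quot_map S y = h (quot_map S x)" if "x \<in> lim_pts S" for x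
  proof -
    have "h (quot_map S x) \<in> quot_map S ` lim_pts S"
      using homeomorphic_imp_surjective_map[OF h] that by (metis imageI quot_map_image topspace_quot_top)
    then show ?thesis by (metis imageE)
  qed
  obtain \<delta> where \<delta>: "\<delta> > 0" "\<And>y y'. y \<in> lim_pts S \<Longrightarrow> y' \<in> lim_pts S \<Longrightarrow>
      mdist \<mu> (quot_map S y) (quot_map S y') < \<delta> \<Longrightarrow> (y N, y' N) \<in> path_edges (lev S N)"
    using quot_dist_of_level[OF fl m] by metis
  have hq: "continuous_map (lim_top S) (mtopology_of \<mu>) (h \<circ> quot_map S)"
    unfolding m using quotient_imp_continuous_map[OF quotient_map_quot_map] homeomorphic_imp_continuous_map[OF h]
    by (rule continuous_map_compose)
  have "(h \<circ> quot_map S) x = (h \<circ> quot_map S) x'" if "(x, x') \<in> lim_rel S" for x x'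
    using quot_map_eq_iff[OF fl, of x x'] that by (simp add: lim_rel_def)
  from level_of_uniform_continuity[OF obj hq this \<delta>(1)] obtain M0
    where M0: "\<And>n x x'. M0 \<le> n \<Longrightarrow> x \<in> lim_pts S \<Longrightarrow> x' \<in> lim_pts S \<Longrightarrow> (x n, x' n) \<in> path_edges (lev S n) \<Longrightarrow>
      mdist \<mu> (h (quot_map S x)) (h (quot_map S x')) < \<delta>"
    by auto
  define M where "M = max M0 (Suc K0)"
  define A where "A u = {p (y N) | x y. x \<in> lim_pts S \<and> y \<in> lim_pts S \<and> quot_map S y = h (quot_map S x) \<and> x M = u}" for u
  have A_close: "\<bar>int a - int a'\<bar> \<le> 1"
    if "a \<in> A u" "a' \<in> A u'" "(u, u') \<in> path_edges (lev S M)" for a a' u u'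
  proof -
    from that(1) obtain x y where x: "x \<in> lim_pts S" "x M = u"
      and y: "y \<in> lim_pts S" "quot_map S y = h (quot_map S x)" "a = p (y N)" unfolding A_def by blast
    from that(2) obtain x' y' where x': "x' \<in> lim_pts S" "x' M = u'"
      and y': "y' \<in> lim_pts S" "quot_map S y' = h (quot_map S x')" "a' = p (y' N)" unfolding A_def by blast
    have "mdist \<mu> (quot_map S y) (quot_map S y') < \<delta>"
      using M0[of M x x'] x x' y(2) y'(2) that(3) by (simp add: M_def)
    from K_mor_edge[OF p \<delta>(2)[OF y(1) y'(1) this]] show ?thesis
      using y y' by (simp add: path_edges_def)
  qed
  have A_lt: "A u \<subseteq> {..<m + 3}" for u
    using K_mor_lt[OF p] by (auto simp: A_def lim_pts_def)
  then have A_fin: "finite (A u)" for u by (rule finite_subset) simp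
  have A_ne: "A u \<noteq> {}" if "u < lev S M" for u
  proof -
    obtain x where "x \<in> lim_pts S" "x M = u" using lim_pts_coord_surj[OF obj \<open>u < lev S M\<close>] by blast
    then show ?thesis using hsurj[of x] unfolding A_def by blast
  qed
  define lo where "lo u = Min (A u)" for u
  define hi where "hi u = Max (A u)" for u
  have lo: "lo u \<in> A u" and hi: "hi u \<in> A u" if "u < lev S M" for u
    using A_ne[OF that] A_fin by (auto simp: lo_def hi_def)
  have lo_le: "lo u \<le> a" and le_hi: "a \<le> hi u" if "a \<in> A u" for a u
    using A_fin that by (auto simp: lo_def hi_def)
  have lohi: "lo u \<le> hi u \<and> hi u \<le> Suc (lo u)" if "u < lev S M" for u
    using A_close[OF lo[OF that] hi[OF that]] lo_le[OF hi[OF that]] that by (simp add: path_edges_def)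
  have lip: "\<bar>int (lo (Suc u)) - int (lo u)\<bar> \<le> 1" if "Suc u < lev S M" for u
    using A_close[OF lo lo, of "Suc u" u] that by (simp add: path_edges_def)
  have path: "\<exists>z<lev S M. c \<in> A z \<and> (\<forall>v\<in>{min u z..max u z}. A v \<inter> G \<noteq> {})"
    if u: "u < lev S M" "a \<in> A u" "a \<in> G"
      and walk: "\<And>n r e. 2 \<le> n \<Longrightarrow> K_mor n (m + 3) r \<Longrightarrow> e < n \<Longrightarrow> r e \<in> G \<Longrightarrow>
        \<exists>z<n. r z = c \<and> (\<forall>v\<in>{min e z..max e z}. r v \<in> G)" for u a c G
  proof -
    from u(2) obtain x0 y0 where x0: "x0 \<in> lim_pts S" "x0 M = u"
      and y0: "y0 \<in> lim_pts S" "quot_map S y0 = h (quot_map S x0)" "a = p (y0 N)" unfolding A_def by blast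
    have "p (y0 N) \<in> G" using y0(3) u(3) by simp
    from homeo_coarse_confluent[OF fl h p walk x0(1) y0(1,2) this, where M = M]
    obtain x y where "x \<in> lim_pts S" "y \<in> lim_pts S" "quot_map S y = h (quot_map S x)" "p (y N) = c"
      and between: "\<And>v. v \<in> {min u (x M)..max u (x M)} \<Longrightarrow>
        \<exists>x\<in>lim_pts S. \<exists>y\<in>lim_pts S. x M = v \<and> quot_map S y = h (quot_map S x) \<and> p (y N) \<in> G"
      unfolding x0(2) by blast
    moreover have "A v \<inter> G \<noteq> {}" if "v \<in> {min u (x M)..max u (x M)}" for v
      using between[OF that] unfolding A_def by blast
    ultimately show ?thesis
      unfolding A_def by (intro exI[of _ "x M"]) (auto simp: lim_pts_def)
  qed
  define L where "L = lev S M - 1"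
  have L: "u \<le> L \<longleftrightarrow> u < lev S M" for u
    using obj[unfolded Komega_obj_def, rule_format, of M] by (auto simp: L_def)
  have down: "\<exists>z\<le>L. lo z = 0 \<and> (\<forall>v\<in>{min u z..max u z}. lo v \<le> lo u)" if "u \<le> L" for u
  proof -
    have u: "u < lev S M" using that L by simp
    have "\<exists>z<lev S M. 0 \<in> A z \<and> (\<forall>v\<in>{min u z..max u z}. A v \<inter> {..lo u} \<noteq> {})"
    proof (rule path[OF u lo[OF u]])
      fix n r e assume r: "2 \<le> n" "K_mor n (m + 3) r" "e < n" "r e \<in> {..lo u}"
      show "\<exists>z<n. r z = 0 \<and> (\<forall>v\<in>{min e z..max e z}. r v \<in> {..lo u})"
        using K_mor_walk(1)[OF r(2,1,3)] r(4) by (meson atMost_iff order_trans)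
    qed simp
    then obtain z where z: "z < lev S M" "0 \<in> A z" "\<And>v. v \<in> {min u z..max u z} \<Longrightarrow> A v \<inter> {..lo u} \<noteq> {}"
      by blast
    have "lo v \<le> lo u" if "v \<in> {min u z..max u z}" for v
    proof -
      from z(3)[OF that] obtain a where "a \<in> A v" "a \<le> lo u" by blast
      then show ?thesis using lo_le[of a v] by simp
    qed
    then show ?thesis using z(1) lo_le[OF z(2)] L by auto
  qed
  have up: "\<exists>t\<le>L. hi t = m + 2 \<and> (\<forall>v\<in>{min u t..max u t}. hi u \<le> hi v)" if "u \<le> L" for u
  proof -
    have u: "u < lev S M" using that L by simp
    have "\<exists>z<lev S M. m + 2 \<in> A z \<and> (\<forall>v\<in>{min u z..max u z}. A v \<inter> {hi u..} \<noteq> {})"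
    proof (rule path[OF u hi[OF u]])
      fix n r e assume r: "2 \<le> n" "K_mor n (m + 3) r" "e < n" "r e \<in> {hi u..}"
      obtain z where z: "z < n" "r z = m + 2" "\<forall>v\<in>{min e z..max e z}. r e \<le> r v"
        using K_mor_walk(2)[OF r(2,1,3)] by auto
      then show "\<exists>z<n. r z = m + 2 \<and> (\<forall>v\<in>{min e z..max e z}. r v \<in> {hi u..})"
        using r(4) by (meson atLeast_iff order_trans)
    qed simp
    then obtain z where z: "z < lev S M" "m + 2 \<in> A z" "\<And>v. v \<in> {min u z..max u z} \<Longrightarrow> A v \<inter> {hi u..} \<noteq> {}"
      by blast
    have "hi u \<le> hi v" if "v \<in> {min u z..max u z}" for v
    proof -
      from z(3)[OF that] obtain a where "a \<in> A v" "hi u \<le> a" by blast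
      then show ?thesis using le_hi[of a v] by simp
    qed
    moreover have "hi z = m + 2" using le_hi[OF z(2)] hi[OF z(1)] A_lt[of z] by fastforce
    ultimately show ?thesis using z(1) L by auto
  qed
  define \<psi> where "\<psi> u = min (lo u - 1) m" for u
  have zig: "zigzag \<psi> m 0 L"
    unfolding \<psi>_def[abs_def] by (rule zigzag_coarse_confluent[OF _ \<open>0 < m\<close> down up]) (use lohi L in auto)
  have \<psi>_lip: "\<bar>int (\<psi> (Suc j)) - int (\<psi> j)\<bar> \<le> 1" if "Suc j < lev S M" for j
    using lip[OF that] by (auto simp: \<psi>_def min_def)
  have onto: "\<psi> ` {..<lev S M} = {..<m + 1}"
  proof
    show "{..<m + 1} \<subseteq> \<psi> ` {..<lev S M}"
    proof
      fix v assume v: "v \<in> {..<m + 1}"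
      from down[OF le0] up[OF le0] obtain z t where zt: "z \<le> L" "lo z = 0" "t \<le> L" "hi t = m + 2"
        by (elim exE conjE)
      have "m + 1 \<le> lo t" using lohi[of t] zt(3,4) L by simp
      then have z: "\<psi> z = 0" and t: "\<psi> t = m" using zt(2) by (simp_all add: \<psi>_def)
      have "max z t < lev S M" using zt L by simp
      then have "\<bar>int (\<psi> (Suc j)) - int (\<psi> j)\<bar> \<le> 1" if "j < max z t" for j
        using that by (intro \<psi>_lip) linarith
      moreover have "\<psi> (min z t) \<le> v \<and> v \<le> \<psi> (max z t) \<or> \<psi> (max z t) \<le> v \<and> v \<le> \<psi> (min z t)"
        using z t v by (cases "z \<le> t") simp_all
      ultimately obtain w where "w \<in> {min z t..max z t}" "\<psi> w = v"
        using discrete_ivt[of "min z t" "max z t" \<psi> v] by fastforce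
      then show "v \<in> \<psi> ` {..<lev S M}" using \<open>max z t < lev S M\<close> by auto
    qed
  qed (auto simp: \<psi>_def)
  have approx: "\<bar>int (\<psi> (x M)) - int (min (p (y N) - 1) m)\<bar> \<le> 1"
    if "x \<in> lim_pts S" "y \<in> lim_pts S" "quot_map S y = h (quot_map S x)" for x y
  proof -
    have "x M < lev S M" using that by (simp add: lim_pts_def)
    moreover have "p (y N) \<in> A (x M)" using that unfolding A_def by blast
    ultimately have "lo (x M) \<le> p (y N)" "p (y N) \<le> Suc (lo (x M))"
      using lo_le le_hi lohi by (blast, meson order_trans)
    then show ?thesis by (auto simp: \<psi>_def min_def)
  qed
  have "M > K0" by (simp add: M_def)
  then show ?thesis using zig onto \<psi>_lip approx unfolding L_def by blast
qed

text \<open>The projection to level \<open>N\<close> is lifted along the composite of the fold of a path with \<open>2 * lev S N\<close>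
  vertices and the truncation that provides the room lost to the error of \<open>1\<close> at both ends.\<close>

lemma homeo_approx_by_automorphism:
  assumes fl: "fraisse_limit S" and m: "mtopology_of \<mu> = quot_top S"
    and h: "homeomorphic_map (quot_top S) (quot_top S) h"
  shows "\<exists>f\<in>Komega_aut S. \<forall>x\<in>lim_pts S. \<forall>y\<in>lim_pts S. quot_map S y = h (quot_map S x) \<longrightarrow>
    (f x N, y N) \<in> path_edges (lev S N)"
proof -
  have obj: "Komega_obj S" using fl by (simp add: fraisse_limit_def)
  define n where "n = lev S N"
  have n: "2 \<le> n" using obj by (simp add: n_def Komega_obj_def)
  \<comment> \<open>The last vertex of the path that is folded onto level \<open>N\<close>.\<close>
  define m' where "m' = 2 * n - 1"
  have m': "0 < m'" "m' + 1 = 2 * n" using n by (auto simp: m'_def)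
  define tent where "tent v = min v (2 * n - 1 - v)" for v
  define clamp where "clamp v = min (v - 1) m'" for v :: nat
  have tent: "K_mor (m' + 1) n tent" "tent m' = 0"
    using K_mor_tent[OF n] m' by (auto simp: tent_def[abs_def] m'_def)
  have "K_mor (m' + 3) n (tent \<circ> clamp)"
    using K_mor_clamp[OF m'(1)] m' by (intro K_mor_comp[OF _ tent(1)]) (auto simp: clamp_def[abs_def])
  then have "\<exists>k>0. \<exists>\<beta>. K_mor (lev S k) (m' + 3) \<beta> \<and> (\<forall>x\<in>lim_pts S. (tent \<circ> clamp) (\<beta> (x k)) = x N)"
    unfolding n_def by (intro fraisse_limit_lift[OF fl]) (simp, assumption)
  then obtain N' p
    where p: "K_mor (lev S N') (m' + 3) p" "\<And>y. y \<in> lim_pts S \<Longrightarrow> tent (clamp (p (y N'))) = y N"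
    unfolding comp_apply by blast
  obtain M \<psi> where "N < M" and \<psi>: "zigzag \<psi> m' 0 (lev S M - 1)" "\<psi> ` {..<lev S M} = {..<m' + 1}"
    "\<And>j. Suc j < lev S M \<Longrightarrow> \<bar>int (\<psi> (Suc j)) - int (\<psi> j)\<bar> \<le> 1"
    "\<And>x y. x \<in> lim_pts S \<Longrightarrow> y \<in> lim_pts S \<Longrightarrow> quot_map S y = h (quot_map S x) \<Longrightarrow>
      \<bar>int (\<psi> (x M)) - int (clamp (p (y N')))\<bar> \<le> 1"
    using homeo_level_approximation[OF fl m h p(1) m'(1), of N] unfolding clamp_def by blast
  have "K_mor (lev S M) (lev S N) (tent \<circ> \<psi>)"
    using K_mor_comp_free_start[OF \<psi>(1) m'(1) \<psi>(2,3) tent] by (simp add: n_def)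
  from fraisse_limit_homogeneous[OF fl this \<open>N < M\<close>] obtain f
    where f: "f \<in> Komega_aut S" "\<And>x. x \<in> lim_pts S \<Longrightarrow> f x N = tent (\<psi> (x M))" by auto
  have "(f x N, y N) \<in> path_edges (lev S N)"
    if xy: "x \<in> lim_pts S" "y \<in> lim_pts S" "quot_map S y = h (quot_map S x)" for x y
  proof -
    have "x M < lev S M" using xy(1) by (simp add: lim_pts_def)
    then have "\<psi> (x M) < m' + 1" using \<psi>(2) by blast
    then have "(\<psi> (x M), clamp (p (y N'))) \<in> path_edges (m' + 1)"
      using \<psi>(4)[OF xy] by (simp add: path_edges_def clamp_def)
    from K_mor_edge[OF tent(1) this] show ?thesis
      using f(2)[OF xy(1)] p(2)[OF xy(2)] by (simp add: n_def)
  qed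
  then show ?thesis using f(1) by blast
qed

theorem corollary5p3:
  fixes S :: inv_seq and m :: "(nat \<Rightarrow> nat) set metric"
  assumes "fraisse_limit S"
    and "mtopology_of m = quot_top S"
  shows "Homeo_top (quot_top S) m closure_of (Phi S ` Komega_aut S) = Homeo (quot_top S)"
proof
  have obj: "Komega_obj S" using assms(1) by (simp add: fraisse_limit_def)
  note top = topspace_Homeo_top[OF assms]
  show "Homeo_top (quot_top S) m closure_of (Phi S ` Komega_aut S) \<subseteq> Homeo (quot_top S)"
    using closure_of_subset_topspace[of "Homeo_top (quot_top S) m"] top by simp
  let ?F = "cfunspace (quot_top S) m"
  interpret F: Metric_space "mspace ?F" "mdist ?F" by (rule Metric_space_mspace_mdist)
  have inF: "Homeo (quot_top S) \<subseteq> mspace ?F"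
    using top unfolding Homeo_top_def by auto
  have q: "continuous_map (lim_top S) (mtopology_of m) (quot_map S)"
    using quotient_imp_continuous_map[OF quotient_map_quot_map] assms(2) by simp
  show "Homeo (quot_top S) \<subseteq> Homeo_top (quot_top S) m closure_of (Phi S ` Komega_aut S)"
  proof
    fix h assume h: "h \<in> Homeo (quot_top S)"
    then have homeo: "homeomorphic_map (quot_top S) (quot_top S) h" by (simp add: Homeo_def)
    have "\<exists>g\<in>Phi S ` Komega_aut S. g \<in> F.mball h \<epsilon>" if "0 < \<epsilon>" for \<epsilon>
    proof -
      have resp: "quot_map S x = quot_map S y" if "(x, y) \<in> lim_rel S" for x y
        using quot_map_eq_iff[OF assms(1), of x y] that by (simp add: lim_rel_def)
      \<comment> \<open>A strict bound at every point bounds the supremum only weakly, hence \<open>\<epsilon> / 2\<close>.\<close>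
      obtain N where N: "\<And>x y. x \<in> lim_pts S \<Longrightarrow> y \<in> lim_pts S \<Longrightarrow> (x N, y N) \<in> path_edges (lev S N) \<Longrightarrow>
          mdist m (quot_map S x) (quot_map S y) < \<epsilon> / 2"
        using level_of_uniform_continuity[OF obj q resp, of "\<epsilon> / 2"] \<open>0 < \<epsilon>\<close> by auto
      obtain f where f: "f \<in> Komega_aut S" "\<And>x y. x \<in> lim_pts S \<Longrightarrow> y \<in> lim_pts S \<Longrightarrow>
          quot_map S y = h (quot_map S x) \<Longrightarrow> (f x N, y N) \<in> path_edges (lev S N)"
        using homeo_approx_by_automorphism[OF assms homeo] by metis
      have fm: "f x \<in> lim_pts S" if "x \<in> lim_pts S" for x
        using f(1) Komega_hom_mem that by (auto simp: Komega_aut_def)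
      note Phi = Phi_well_defined[OF assms(1) f(1)]
      have "mdist m (h c) (Phi S f c) \<le> \<epsilon> / 2" if c: "c \<in> topspace (quot_top S)" for c
      proof -
        obtain x where x: "x \<in> lim_pts S" "c = quot_map S x"
          using c quot_map_image[of S] by (metis imageE topspace_quot_top)
        have "h c \<in> quot_map S ` lim_pts S"
          using homeomorphic_imp_surjective_map[OF homeo] c by (metis imageI quot_map_image topspace_quot_top)
        then obtain y where y: "y \<in> lim_pts S" "quot_map S y = h (quot_map S x)" using x by (metis imageE)
        show ?thesis
          using N[OF fm[OF x(1)] y(1) f(2)[OF x(1) y]] Phi(2)[OF x(1)] x(2) y(2)
          by (simp add: mdist_commute)
      qed
      then have "mdist ?F h (Phi S f) \<le> \<epsilon> / 2"
        using \<open>0 < \<epsilon>\<close> by (intro mdist_cfunspace_le) auto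
      then have "Phi S f \<in> F.mball h \<epsilon>"
        unfolding F.in_mball using h Phi(1) inF \<open>0 < \<epsilon>\<close> by (intro conjI subsetD[OF inF]) simp_all
      then show ?thesis using f(1) by blast
    qed
    then have "h \<in> mtopology_of ?F closure_of (Phi S ` Komega_aut S)"
      using h inF unfolding mtopology_of_def F.metric_closure_of by blast
    moreover have "Phi S ` Komega_aut S \<subseteq> Homeo (quot_top S)"
      using Phi_well_defined(1)[OF assms(1)] by blast
    ultimately show "h \<in> Homeo_top (quot_top S) m closure_of (Phi S ` Komega_aut S)"
      using h unfolding Homeo_top_def by (simp add: closure_of_subtopology Int_absorb1)
  qed
qed

end
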